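(* Let $\mathcal{K}$ be the C*-algebra of compact operators on a separable infinite-dimensional Hilbert space, and let $B$ be its closed unit ball. Then the multiplication $B\times B\to\mathcal{K}$, $(a,b)\mapsto ab$, is not jointly continuous for the weakly-uniform topology $\mathrm{wu}$ of $\mathcal{K}$. In particular, the multiplication of a separable C*-algebra is in general not jointly continuous on bounded sets for $\mathrm{wu}$.
   Context: For a separable C*-algebra $A$ with state space $S(A)$ (weak* topology) and each weak* compact subset $K$ of $S(A)$, let $p_K(a)=\sup_{\varphi\in K}|\varphi(a)|$ for $a\in A$. The weakly-uniform topology $\mathrm{wu}$ on $A$ is the locally convex topology generated by all the seminorms $p_K$, $K$ ranging over the weak* compact subsets of $S(A)$. *)

theory Defs
  imports "HOL-Analysis.Analysis"
begin

section \<open>Complex Hilbert spaces\<close>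

text \<open>The inner product is linear in its first argument.\<close>

class complex_inner = real_normed_vector +
  fixes scaleC :: "complex \<Rightarrow> 'a \<Rightarrow> 'a"
    and cinner :: "'a \<Rightarrow> 'a \<Rightarrow> complex"
  assumes scaleC_add_right: "scaleC c (x + y) = scaleC c x + scaleC c y"
    and scaleC_add_left: "scaleC (c + d) x = scaleC c x + scaleC d x"
    and scaleC_scaleC: "scaleC c (scaleC d x) = scaleC (c * d) x"
    and scaleC_of_real: "scaleC (complex_of_real r) x = r *\<^sub>R x"
    and cinner_commute: "cinner x y = cnj (cinner y x)"
    and cinner_add_left: "cinner (x + y) z = cinner x z + cinner y z"
    and cinner_scaleC_left: "cinner (scaleC c x) y = c * cinner x y"
    and cinner_self_nonneg: "cinner x x \<in> \<real>\<^sub>\<ge>\<^sub>0"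
    and norm_eq_sqrt_cinner: "norm x = sqrt (Re (cinner x x))"

class chilbert_space = complex_inner + complete_space

lemma vector_space_scaleC: "vector_space (scaleC :: complex \<Rightarrow> 'a::complex_inner \<Rightarrow> 'a)"
proof
  show "scaleC 1 x = x" for x :: 'a
    using scaleC_of_real[of 1 x] by simp
qed (simp_all add: scaleC_add_right scaleC_add_left scaleC_scaleC)

definition infinite_dimensional :: "'h::complex_inner itself \<Rightarrow> bool" where
  "infinite_dimensional _ \<longleftrightarrow>
     \<not> (\<exists>F::'h set. finite F \<and> module.span scaleC F = UNIV)"


section \<open>C*-algebras\<close>

text \<open>
  C*-algebras are carrier-based, so that the algebra of compact operators is one without a
  new type.  No unit is required; subtraction is derived from addition and scaling.
\<close>

record 'a cstar_record =
  carrier :: "'a set"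
  czero :: 'a
  cadd :: "'a \<Rightarrow> 'a \<Rightarrow> 'a"
  cscale :: "complex \<Rightarrow> 'a \<Rightarrow> 'a"
  cmult :: "'a \<Rightarrow> 'a \<Rightarrow> 'a"
  cstar :: "'a \<Rightarrow> 'a"
  cnorm :: "'a \<Rightarrow> real"

definition cdiff :: "'a cstar_record \<Rightarrow> 'a \<Rightarrow> 'a \<Rightarrow> 'a" where
  "cdiff A x y = cadd A x (cscale A (-1) y)"

locale cstar_algebra =
  fixes A :: "'a cstar_record"
  assumes zero_closed: "czero A \<in> carrier A"
    and add_closed: "\<lbrakk>x \<in> carrier A; y \<in> carrier A\<rbrakk> \<Longrightarrow> cadd A x y \<in> carrier A"
    and scale_closed: "x \<in> carrier A \<Longrightarrow> cscale A c x \<in> carrier A"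
    and mult_closed: "\<lbrakk>x \<in> carrier A; y \<in> carrier A\<rbrakk> \<Longrightarrow> cmult A x y \<in> carrier A"
    and star_closed: "x \<in> carrier A \<Longrightarrow> cstar A x \<in> carrier A"
    and add_assoc: "\<lbrakk>x \<in> carrier A; y \<in> carrier A; z \<in> carrier A\<rbrakk> \<Longrightarrow>
      cadd A (cadd A x y) z = cadd A x (cadd A y z)"
    and add_commute: "\<lbrakk>x \<in> carrier A; y \<in> carrier A\<rbrakk> \<Longrightarrow> cadd A x y = cadd A y x"
    and add_zero: "x \<in> carrier A \<Longrightarrow> cadd A x (czero A) = x"
    and diff_self: "x \<in> carrier A \<Longrightarrow> cdiff A x x = czero A"
    and scale_add_right: "\<lbrakk>x \<in> carrier A; y \<in> carrier A\<rbrakk> \<Longrightarrow>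
      cscale A c (cadd A x y) = cadd A (cscale A c x) (cscale A c y)"
    and scale_add_left: "x \<in> carrier A \<Longrightarrow>
      cscale A (c + d) x = cadd A (cscale A c x) (cscale A d x)"
    and scale_scale: "x \<in> carrier A \<Longrightarrow> cscale A c (cscale A d x) = cscale A (c * d) x"
    and scale_one: "x \<in> carrier A \<Longrightarrow> cscale A 1 x = x"
    and mult_assoc: "\<lbrakk>x \<in> carrier A; y \<in> carrier A; z \<in> carrier A\<rbrakk> \<Longrightarrow>
      cmult A (cmult A x y) z = cmult A x (cmult A y z)"
    and mult_add_left: "\<lbrakk>x \<in> carrier A; y \<in> carrier A; z \<in> carrier A\<rbrakk> \<Longrightarrow>
      cmult A (cadd A x y) z = cadd A (cmult A x z) (cmult A y z)"
    and mult_add_right: "\<lbrakk>x \<in> carrier A; y \<in> carrier A; z \<in> carrier A\<rbrakk> \<Longrightarrow>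
      cmult A x (cadd A y z) = cadd A (cmult A x y) (cmult A x z)"
    and mult_scale_left: "\<lbrakk>x \<in> carrier A; y \<in> carrier A\<rbrakk> \<Longrightarrow>
      cmult A (cscale A c x) y = cscale A c (cmult A x y)"
    and mult_scale_right: "\<lbrakk>x \<in> carrier A; y \<in> carrier A\<rbrakk> \<Longrightarrow>
      cmult A x (cscale A c y) = cscale A c (cmult A x y)"
    and star_star: "x \<in> carrier A \<Longrightarrow> cstar A (cstar A x) = x"
    and star_add: "\<lbrakk>x \<in> carrier A; y \<in> carrier A\<rbrakk> \<Longrightarrow>
      cstar A (cadd A x y) = cadd A (cstar A x) (cstar A y)"
    and star_scale: "x \<in> carrier A \<Longrightarrow> cstar A (cscale A c x) = cscale A (cnj c) (cstar A x)"
    and star_mult: "\<lbrakk>x \<in> carrier A; y \<in> carrier A\<rbrakk> \<Longrightarrow>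
      cstar A (cmult A x y) = cmult A (cstar A y) (cstar A x)"
    and norm_nonneg: "x \<in> carrier A \<Longrightarrow> cnorm A x \<ge> 0"
    and norm_zero_iff: "x \<in> carrier A \<Longrightarrow> cnorm A x = 0 \<longleftrightarrow> x = czero A"
    and norm_triangle: "\<lbrakk>x \<in> carrier A; y \<in> carrier A\<rbrakk> \<Longrightarrow>
      cnorm A (cadd A x y) \<le> cnorm A x + cnorm A y"
    and norm_scale: "x \<in> carrier A \<Longrightarrow> cnorm A (cscale A c x) = cmod c * cnorm A x"
    and norm_mult: "\<lbrakk>x \<in> carrier A; y \<in> carrier A\<rbrakk> \<Longrightarrow>
      cnorm A (cmult A x y) \<le> cnorm A x * cnorm A y"
    and norm_star_mult_self: "x \<in> carrier A \<Longrightarrow> cnorm A (cmult A (cstar A x) x) = (cnorm A x)\<^sup>2"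
    and complete: "\<lbrakk>\<And>n. s n \<in> carrier A;
        \<And>e. e > 0 \<Longrightarrow> \<exists>N::nat. \<forall>m\<ge>N. \<forall>n\<ge>N. cnorm A (cdiff A (s m) (s n)) < e\<rbrakk> \<Longrightarrow>
      \<exists>x\<in>carrier A. (\<lambda>n. cnorm A (cdiff A (s n) x)) \<longlonglongrightarrow> 0"

definition cstar_separable :: "'a cstar_record \<Rightarrow> bool" where
  "cstar_separable A \<longleftrightarrow>
     (\<exists>D. countable D \<and> D \<subseteq> carrier A \<and> (\<forall>x\<in>carrier A. \<forall>e>0. \<exists>d\<in>D. cnorm A (cdiff A x d) < e))"

definition cstar_bounded :: "'a cstar_record \<Rightarrow> 'a set \<Rightarrow> bool" where
  "cstar_bounded A S \<longleftrightarrow> S \<subseteq> carrier A \<and> (\<exists>r. \<forall>x\<in>S. cnorm A x \<le> r)"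

definition unit_ball :: "'a cstar_record \<Rightarrow> 'a set" where
  "unit_ball A = {x \<in> carrier A. cnorm A x \<le> 1}"


section \<open>States and the weakly-uniform topology\<close>

definition bounded_functional :: "'a cstar_record \<Rightarrow> ('a \<Rightarrow> complex) \<Rightarrow> bool" where
  "bounded_functional A \<phi> \<longleftrightarrow>
     (\<forall>x\<in>carrier A. \<forall>y\<in>carrier A. \<phi> (cadd A x y) = \<phi> x + \<phi> y) \<and>
     (\<forall>c. \<forall>x\<in>carrier A. \<phi> (cscale A c x) = c * \<phi> x) \<and>
     (\<exists>M. \<forall>x\<in>carrier A. cmod (\<phi> x) \<le> M * cnorm A x)"

definition functional_norm :: "'a cstar_record \<Rightarrow> ('a \<Rightarrow> complex) \<Rightarrow> real" where
  "functional_norm A \<phi> = (SUP x\<in>unit_ball A. cmod (\<phi> x))"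

text \<open>
  Functionals on \<open>A\<close> are extensional: they carry the value \<open>undefined\<close> off the carrier, so that
  each functional on the carrier is represented by exactly one HOL function, as
  \<^const>\<open>product_topology\<close> expects.
\<close>

definition state_space :: "'a cstar_record \<Rightarrow> ('a \<Rightarrow> complex) set" where
  "state_space A = {\<phi> \<in> extensional (carrier A).
     bounded_functional A \<phi> \<and>
     (\<forall>x\<in>carrier A. \<phi> (cmult A (cstar A x) x) \<in> \<real>\<^sub>\<ge>\<^sub>0) \<and>
     functional_norm A \<phi> = 1}"

text \<open>The weak* topology is the topology of pointwise convergence on the carrier.\<close>

definition weak_star_topology :: "'a cstar_record \<Rightarrow> ('a \<Rightarrow> complex) topology" where
  "weak_star_topology A =
     subtopology (product_topology (\<lambda>_. euclidean) (carrier A)) (state_space A)"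

text \<open>The supremum of the empty set of nonnegative reals is \<open>0\<close>.\<close>

definition state_seminorm :: "('a \<Rightarrow> complex) set \<Rightarrow> 'a \<Rightarrow> real" where
  "state_seminorm K a = (if K = {} then 0 else (SUP \<phi>\<in>K. cmod (\<phi> a)))"

definition wu_topology :: "'a cstar_record \<Rightarrow> 'a topology" where
  "wu_topology A = topology_generated_by
     {{b \<in> carrier A. state_seminorm K (cdiff A b a) < \<epsilon>} | K a \<epsilon>.
        compactin (weak_star_topology A) K \<and> a \<in> carrier A \<and> \<epsilon> > 0}"

definition mult_jointly_continuous_on :: "'a cstar_record \<Rightarrow> 'a set \<Rightarrow> bool" where
  "mult_jointly_continuous_on A S \<longleftrightarrow>
     continuous_map
       (prod_topology (subtopology (wu_topology A) S) (subtopology (wu_topology A) S))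
       (wu_topology A)
       (\<lambda>(a, b). cmult A a b)"


section \<open>The C*-algebra of compact operators\<close>

definition adjoint_op :: "('h::chilbert_space \<Rightarrow> 'h) \<Rightarrow> 'h \<Rightarrow> 'h" where
  "adjoint_op T = (THE S. \<forall>x y. cinner (T x) y = cinner x (S y))"

text \<open>
  Compact operators are the linear maps taking the closed unit ball to a relatively compact
  set; boundedness follows.
\<close>

definition compact_operators :: "('h::chilbert_space \<Rightarrow> 'h) cstar_record" where
  "compact_operators = \<lparr>
     carrier = {T. Vector_Spaces.linear scaleC scaleC T \<and> compact (closure (T ` cball 0 1))},
     czero = (\<lambda>x. 0),
     cadd = (\<lambda>S T x. S x + T x),
     cscale = (\<lambda>c T x. scaleC c (T x)),
     cmult = (\<lambda>S T. S \<circ> T),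
     cstar = adjoint_op,
     cnorm = onorm\<rparr>"

end

theory Submission
  imports Defs
begin

text \<open>
  Let \<open>e i j\<close> be the matrix units of the compact operators with respect to an orthonormal basis. The
  sequences \<open>e 0 n\<close> and \<open>e n 0\<close> lie in the unit ball and both converge to \<open>0\<close> in the weakly-uniform
  topology, while their product \<open>e 0 n \<cdot> e n 0 = e 0 0\<close> is constant and is not \<open>0\<close>. Since a jointly
  continuous multiplication preserves limits of sequences of pairs, it cannot be jointly continuous.

  The point is the convergence, which is uniform over a weak* compact set \<open>K\<close> of states. Put
  \<open>p n = e 0 0 + \<dots> + e (n - 1) (n - 1)\<close>, an increasing sequence of projections with \<open>p n x \<rightarrow> x\<close> in norm
  for compact \<open>x\<close>. For a state \<open>\<phi>\<close> the numbers \<open>\<phi> (p n)\<close> increase, and they increase to \<open>1\<close>: for \<open>x\<close> in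
  the unit ball the Cauchy-Schwarz inequality gives \<open>\<bar>\<phi> (p n x)\<bar>\<^sup>2 \<le> \<phi> (p n)\<close>, and \<open>\<bar>\<phi> x\<bar>\<close> can be chosen
  close to the norm \<open>1\<close> of \<open>\<phi>\<close>. By Dini's argument the convergence is uniform on \<open>K\<close>
  (\<open>compact_states_uniformly_tight\<close>). As \<open>\<phi> (p n) + \<phi> (e n n) \<le> 1\<close>, the numbers \<open>\<phi> (e n n)\<close> tend to \<open>0\<close>
  uniformly on \<open>K\<close>, and by Cauchy-Schwarz they dominate both \<open>\<bar>\<phi> (e 0 n)\<bar>\<^sup>2\<close> and \<open>\<bar>\<phi> (e n 0)\<bar>\<^sup>2\<close>
  (\<open>state_unit_bound\<close>).

  This argument speaks of an abstract C*-algebra with matrix units, the locale \<open>cstar_matrix_units\<close>, so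
  that it serves both halves of the theorem. For a separable infinite-dimensional Hilbert space the
  compact operators are an instance, because an orthonormal basis exists
  (\<open>orthonormal_basis_exists\<close>), the basis projections converge in norm on compact operators
  (\<open>proj_comp_compact_tendsto\<close>), and the compact operators form a C*-algebra
  (\<open>cstar_algebra_compact_operators\<close>; adjoints come from the Riesz representation theorem and are compact
  by Schauder's argument). The second half asks for a separable C*-algebra whose elements are infinite
  matrices: the compact operators on the space of square-summable sequences, transported along the map
  that sends an operator to its matrix entries.
\<close>

section \<open>Positive forms and Hilbert space geometry\<close>

text \<open>
  The Cauchy-Schwarz inequality in coordinates: the hypothesis says that the form with matrix entries
  \<open>A, B, C, D\<close> is positive on all vectors \<open>(1, c)\<close>. It is applied both to inner products and to states.
\<close>

lemma psd_form_bound: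
  fixes A B C D :: complex
  assumes psd: "\<And>c. A + c * B + cnj c * C + (c * cnj c) * D \<in> \<real>\<^sub>\<ge>\<^sub>0"
    and A: "A \<in> \<real>\<^sub>\<ge>\<^sub>0" and D: "D \<in> \<real>\<^sub>\<ge>\<^sub>0"
  shows "C = cnj B" and "(cmod B)\<^sup>2 \<le> Re A * Re D"
proof -
  have A': "Im A = 0" "Re A \<ge> 0" and D': "Im D = 0" "Re D \<ge> 0"
    using A D by (auto simp: complex_nonneg_Reals_iff)
  have "Im B + Im C = 0"
    using psd[of 1] A' D' by (simp add: complex_nonneg_Reals_iff)
  moreover have "Re B - Re C = 0"
    using psd[of \<i>] A' D' by (simp add: complex_nonneg_Reals_iff)
  ultimately show C: "C = cnj B" by (simp add: complex_eq_iff)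
  define b where "b = (cmod B)\<^sup>2"
  have b: "B * cnj B = of_real b" "cnj B * B = of_real b"
    unfolding b_def by (metis complex_norm_square mult.commute)+
  have quad: "Re A + 2 * s * b + s\<^sup>2 * b * Re D \<ge> 0" for s :: real
  proof -
    \<comment> \<open>Among all scalars of a given modulus, the real multiples of \<open>cnj B\<close> make the mixed terms extremal.\<close>
    let ?c = "of_real s * cnj B"
    have "A + ?c * B + cnj ?c * C + (?c * cnj ?c) * D
        = A + 2 * of_real s * (cnj B * B) + (of_real s)\<^sup>2 * (cnj B * B) * D"
      unfolding C by (simp add: power2_eq_square algebra_simps)
    also have "\<dots> = A + of_real (2 * s * b) + of_real (s\<^sup>2 * b) * D"
      unfolding b by simp
    finally have "A + ?c * B + cnj ?c * C + (?c * cnj ?c) * D = \<dots>" .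
    with psd[of ?c] have "Re (A + of_real (2 * s * b) + of_real (s\<^sup>2 * b) * D) \<ge> 0"
      by (metis complex_nonneg_Reals_iff)
    then show ?thesis by simp
  qed
  have "b \<ge> 0" by (simp add: b_def)
  show "(cmod B)\<^sup>2 \<le> Re A * Re D"
  proof (cases "Re D = 0")
    case True
    have "b = 0"
    proof (rule ccontr)
      assume "b \<noteq> 0"
      then show False
        \<comment> \<open>With \<open>D = 0\<close> the quadratic is affine in \<open>s\<close>; at this \<open>s\<close> it equals \<open>-1\<close>.\<close>
        using quad[of "- (Re A + 1) / (2 * b)"] True by (simp add: field_simps)
    qed
    then show ?thesis using True b_def by simp
  next
    case False
    with D' have "Re D > 0" by simp
    have "Re A - b / Re D \<ge> 0"
      \<comment> \<open>The minimum of the quadratic.\<close>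
      using quad[of "- 1 / Re D"] \<open>Re D > 0\<close> by (simp add: power2_eq_square field_simps)
    then show ?thesis
      using \<open>Re D > 0\<close> unfolding b_def[symmetric] by (simp add: field_simps)
  qed
qed

subclass (in chilbert_space) banach ..

lemma scaleC_one [simp]: "scaleC 1 (x::'a::complex_inner) = x"
  using scaleC_of_real[of 1 x] by simp

lemma scaleC_zero_left [simp]: "scaleC 0 (x::'a::complex_inner) = 0"
  using scaleC_of_real[of 0 x] by simp

lemma scaleC_minus_one [simp]: "scaleC (-1) (x::'a::complex_inner) = - x"
  using scaleC_of_real[of "-1" x] by simp

lemma scaleC_zero_right [simp]: "scaleC c (0::'a::complex_inner) = 0"
  using scaleC_add_right[of c 0 0] by simp

lemma scaleC_minus_right: "scaleC c (- x) = - scaleC c (x::'a::complex_inner)"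
  using scaleC_add_right[of c x "-x"] by (simp add: eq_neg_iff_add_eq_0 add.commute)

lemma scaleC_diff_right: "scaleC c (x - y) = scaleC c x - scaleC c (y::'a::complex_inner)"
  using scaleC_add_right[of c x "-y"] by (simp add: scaleC_minus_right)

lemma scaleC_diff_left: "scaleC (c - d) x = scaleC c x - scaleC d (x::'a::complex_inner)"
  using scaleC_add_left[of "c - d" d x] by simp

lemma scaleC_sum_right: "scaleC c (\<Sum>i\<in>I. f i) = (\<Sum>i\<in>I. scaleC c (f i :: 'a::complex_inner))"
  by (induction I rule: infinite_finite_induct) (simp_all add: scaleC_add_right)

lemma cinner_add_right: "cinner x (y + z) = cinner x y + cinner x (z::'a::complex_inner)"
  by (metis cinner_add_left cinner_commute complex_cnj_add)

lemma cinner_scaleC_right: "cinner x (scaleC c y) = cnj c * cinner x (y::'a::complex_inner)"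
  by (metis cinner_scaleC_left cinner_commute complex_cnj_mult)

lemma cinner_zero_left [simp]: "cinner 0 (y::'a::complex_inner) = 0"
  using cinner_scaleC_left[of 0 0 y] by simp

lemma cinner_zero_right [simp]: "cinner (y::'a::complex_inner) 0 = 0"
  by (metis cinner_zero_left cinner_commute complex_cnj_zero)

lemma cinner_minus_left: "cinner (- x) (y::'a::complex_inner) = - cinner x y"
  using cinner_scaleC_left[of "-1" x y] by simp

lemma cinner_minus_right: "cinner x (- y::'a::complex_inner) = - cinner x y"
  using cinner_scaleC_right[of x "-1" y] by simp

lemma cinner_diff_left: "cinner (x - z) (y::'a::complex_inner) = cinner x y - cinner z y"
  using cinner_add_left[of x "-z" y] by (simp add: cinner_minus_left)

lemma cinner_diff_right: "cinner y (x - z::'a::complex_inner) = cinner y x - cinner y z"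
  using cinner_add_right[of y x "-z"] by (simp add: cinner_minus_right)

lemma cinner_sum_left: "cinner (\<Sum>i\<in>I. f i) (y::'a::complex_inner) = (\<Sum>i\<in>I. cinner (f i) y)"
  by (induction I rule: infinite_finite_induct) (simp_all add: cinner_add_left)

lemma cinner_sum_right: "cinner (y::'a::complex_inner) (\<Sum>i\<in>I. f i) = (\<Sum>i\<in>I. cinner y (f i))"
  by (induction I rule: infinite_finite_induct) (simp_all add: cinner_add_right)

lemma cinner_self: "cinner x (x::'a::complex_inner) = of_real ((norm x)\<^sup>2)"
proof -
  have "Re (cinner x x) \<ge> 0" "Im (cinner x x) = 0"
    using cinner_self_nonneg[of x] by (simp_all add: complex_nonneg_Reals_iff)
  then show ?thesis by (simp add: norm_eq_sqrt_cinner complex_eq_iff)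
qed

lemma cinner_Cauchy_Schwarz: "cmod (cinner x y) \<le> norm x * norm (y::'a::complex_inner)"
proof -
  have "cinner x x + c * cinner y x + cnj c * cinner x y + (c * cnj c) * cinner y y \<in> \<real>\<^sub>\<ge>\<^sub>0" for c
    using cinner_self_nonneg[of "x + scaleC c y"]
    by (simp add: cinner_add_left cinner_add_right cinner_scaleC_left cinner_scaleC_right algebra_simps)
  from psd_form_bound(2)[OF this cinner_self_nonneg cinner_self_nonneg]
  have "(cmod (cinner y x))\<^sup>2 \<le> (norm x * norm y)\<^sup>2"
    by (simp add: cinner_self power_mult_distrib)
  then have "cmod (cinner y x) \<le> norm x * norm y"
    by (rule power2_le_imp_le) simp
  then show ?thesis by (metis cinner_commute complex_mod_cnj)
qed

lemma norm_scaleC: "norm (scaleC c x) = cmod c * norm (x::'a::complex_inner)"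
proof -
  have "cinner (scaleC c x) (scaleC c x) = (c * cnj c) * cinner x x"
    by (simp add: cinner_scaleC_left cinner_scaleC_right)
  then have "complex_of_real ((norm (scaleC c x))\<^sup>2) = of_real ((cmod c)\<^sup>2 * (norm x)\<^sup>2)"
    by (simp only: cinner_self complex_norm_square of_real_mult)
  then have "(norm (scaleC c x))\<^sup>2 = (cmod c * norm x)\<^sup>2"
    by (simp only: of_real_eq_iff power_mult_distrib)
  then show ?thesis by (rule power2_eq_imp_eq) simp_all
qed

lemma bounded_linear_cinner_left: "bounded_linear (\<lambda>x. cinner x (y::'a::complex_inner))"
proof (rule bounded_linear_intro[where K = "norm y"])
  show "cinner (r *\<^sub>R x) y = r *\<^sub>R cinner x y" for r and x :: 'a
    by (metis cinner_scaleC_left scaleC_of_real scaleR_conv_of_real)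
qed (rule cinner_add_left cinner_Cauchy_Schwarz)+

lemma bounded_linear_cinner_right: "bounded_linear (\<lambda>x. cinner (y::'a::complex_inner) x)"
proof (rule bounded_linear_intro[where K = "norm y"])
  show "cinner y (r *\<^sub>R x) = r *\<^sub>R cinner y x" for r and x :: 'a
    by (metis cinner_scaleC_right scaleC_of_real scaleR_conv_of_real complex_cnj_complex_of_real)
  show "cmod (cinner y x) \<le> norm x * norm y" for x :: 'a
    using cinner_Cauchy_Schwarz[of y x] by (simp add: mult.commute)
qed (rule cinner_add_right)

lemma bounded_linear_scaleC: "bounded_linear (\<lambda>x. scaleC c (x::'a::complex_inner))"
proof (rule bounded_linear_intro[where K = "cmod c"])
  show "scaleC c (r *\<^sub>R x) = r *\<^sub>R scaleC c x" for r and x :: 'a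
    by (metis scaleC_scaleC scaleC_of_real mult.commute)
qed (simp_all add: scaleC_add_right norm_scaleC mult.commute)

lemma bounded_linear_scaleC_left: "bounded_linear (\<lambda>c. scaleC c (x::'a::complex_inner))"
proof (rule bounded_linear_intro[where K = "norm x"])
  show "scaleC (r *\<^sub>R c) x = r *\<^sub>R scaleC c x" for r and c :: complex
    by (metis scaleC_scaleC scaleC_of_real scaleR_conv_of_real)
qed (simp_all add: scaleC_add_left norm_scaleC)

lemmas tendsto_cinner_left = bounded_linear.tendsto[OF bounded_linear_cinner_left]
lemmas tendsto_scaleC_right = bounded_linear.tendsto[OF bounded_linear_scaleC]

lemma cinner_eqI: "(\<And>x. cinner x y = cinner x z) \<Longrightarrow> y = (z::'a::complex_inner)"
  by (metis cinner_diff_right cinner_self eq_iff_diff_eq_0 of_real_eq_0_iff power_eq_0_iff norm_eq_zero)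

lemma norm_add_square: "(norm (x + y))\<^sup>2 = (norm x)\<^sup>2 + 2 * Re (cinner x y) + (norm (y::'a::complex_inner))\<^sup>2"
proof -
  have "Re (cinner (x + y) (x + y)) = Re (cinner x x) + 2 * Re (cinner x y) + Re (cinner y y)"
    using cinner_commute[of y x] by (simp add: cinner_add_left cinner_add_right)
  then show ?thesis by (simp add: cinner_self)
qed

lemma parallelogram_law:
  "(norm (x + y))\<^sup>2 + (norm (x - y))\<^sup>2 = 2 * (norm x)\<^sup>2 + 2 * (norm (y::'a::complex_inner))\<^sup>2"
  using norm_add_square[of x y] norm_add_square[of x "-y"] by (simp add: cinner_minus_right)

text \<open>
  The representing vector is found variationally: it minimises
  \<open>g x = \<parallel>x\<parallel>\<^sup>2 - 2 Re (f x)\<close>.  The parallelogram law makes every minimising sequence Cauchy, and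
  the first-order condition at the minimum is the desired identity.
\<close>

lemma Riesz_representation:
  fixes f :: "'a::chilbert_space \<Rightarrow> complex"
  assumes add: "\<And>x y. f (x + y) = f x + f y"
    and scale: "\<And>c x. f (scaleC c x) = c * f x"
    and bound: "\<And>x. cmod (f x) \<le> M * norm x"
  shows "\<exists>y. \<forall>x. f x = cinner x y"
proof -
  define g where "g x = (norm x)\<^sup>2 - 2 * Re (f x)" for x
  have lin: "bounded_linear f"
  proof (rule bounded_linear_intro[where K = M])
    show "f (r *\<^sub>R x) = r *\<^sub>R f x" for r x
      by (metis scale scaleC_of_real scaleR_conv_of_real)
  qed (use add bound in \<open>simp_all add: mult.commute\<close>)
  have ge: "g x \<ge> - M\<^sup>2" for x
  proof -
    have "Re (f x) \<le> M * norm x"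
      using bound[of x] complex_Re_le_cmod[of "f x"] by linarith
    moreover have "(norm x - M)\<^sup>2 \<ge> 0" by simp
    ultimately show ?thesis unfolding g_def by (simp add: power2_eq_square algebra_simps)
  qed
  define m where "m = (INF x. g x)"
  have bdd: "bdd_below (range g)" using ge by (auto intro!: bdd_belowI)
  have m_le: "m \<le> g x" for x unfolding m_def by (rule cINF_lower[OF bdd]) simp
  have "\<exists>x. g x < m + inverse (real (Suc n))" for n
  proof -
    have "Inf (range g) < m + inverse (real (Suc n))" unfolding m_def by simp
    from cInf_lessD[OF _ this] show ?thesis by auto
  qed
  then obtain s where s: "\<And>n. g (s n) < m + inverse (real (Suc n))" by metis
  \<comment> \<open>The parallelogram law for \<open>x\<close>, \<open>y\<close>, together with \<open>m \<le> g ((x + y) / 2)\<close>.\<close>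
  have near: "(norm (x - y))\<^sup>2 \<le> 2 * (g x - m) + 2 * (g y - m)" for x y
  proof -
    let ?z = "(1/2) *\<^sub>R (x + y)"
    have "(norm ?z)\<^sup>2 = (norm (x + y))\<^sup>2 / 4" by (simp add: power2_eq_square)
    moreover have "Re (f ?z) = (Re (f x) + Re (f y)) / 2"
      by (simp add: linear_scale[OF bounded_linear.linear[OF lin]] add)
    ultimately have "g ?z = (norm (x + y))\<^sup>2 / 4 - (Re (f x) + Re (f y))"
      by (simp add: g_def)
    with m_le[of ?z] parallelogram_law[of x y] show ?thesis
      by (simp add: g_def field_simps)
  qed
  have "Cauchy s"
  proof (rule metric_CauchyI)
    fix e :: real assume "e > 0"
    then obtain N where N: "inverse (real (Suc N)) < e\<^sup>2 / 4"
      using reals_Archimedean[of "e\<^sup>2 / 4"] by auto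
    have small: "g (s n) - m < e\<^sup>2 / 4" if "n \<ge> N" for n
    proof -
      have "inverse (real (Suc n)) \<le> inverse (real (Suc N))" using that by simp
      then show ?thesis using s[of n] N by linarith
    qed
    have "dist (s j) (s k) < e" if "j \<ge> N" "k \<ge> N" for j k
    proof -
      have "(norm (s j - s k))\<^sup>2 < e\<^sup>2"
        using near[of "s j" "s k"] small[OF that(1)] small[OF that(2)] by argo
      then show ?thesis
        using \<open>e > 0\<close> by (simp add: dist_norm power2_less_imp_less)
    qed
    then show "\<exists>M. \<forall>m\<ge>M. \<forall>n\<ge>M. dist (s m) (s n) < e" by blast
  qed
  then obtain y where y: "s \<longlonglongrightarrow> y" using Cauchy_convergent convergent_def by blast
  have "(\<lambda>n. g (s n)) \<longlonglongrightarrow> g y"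
    unfolding g_def by (intro tendsto_intros bounded_linear.tendsto[OF lin] y)
  moreover have "(\<lambda>n. m + inverse (real (Suc n))) \<longlonglongrightarrow> m + 0"
    by (intro tendsto_intros LIMSEQ_inverse_real_of_nat)
  ultimately have "g y \<le> m"
    using s by (intro LIMSEQ_le[of "\<lambda>n. g (s n)" _ "\<lambda>n. m + inverse (real (Suc n))"]) (auto intro: less_imp_le)
  then have min: "g y \<le> g x" for x using m_le[of x] by linarith
  have Re_eq: "Re (cinner x y) = Re (f x)" for x
  proof (rule ccontr)
    define d where "d = Re (cinner x y) - Re (f x)"
    assume "Re (cinner x y) \<noteq> Re (f x)"
    then have d: "d \<noteq> 0" by (simp add: d_def)
    \<comment> \<open>Perturbing the minimiser in the direction \<open>x\<close>.\<close>
    have ineq: "0 \<le> 2 * t * d + t\<^sup>2 * (norm x)\<^sup>2" for t :: real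
    proof -
      have "Re (cinner y (t *\<^sub>R x)) = t * Re (cinner x y)"
        using linear_scale[OF bounded_linear.linear[OF bounded_linear_cinner_right], of y t x] cinner_commute[of y x]
        by simp
      then show ?thesis
        using min[of "y + t *\<^sub>R x"] norm_add_square[of y "t *\<^sub>R x"]
        by (simp add: g_def d_def add linear_scale[OF bounded_linear.linear[OF lin]] power_mult_distrib algebra_simps)
    qed
    have "x \<noteq> 0" using d linear_0[OF bounded_linear.linear[OF lin]] by (auto simp: d_def)
    then have "(norm x)\<^sup>2 > 0" by simp
    then have "2 * (- d / (norm x)\<^sup>2) * d + (- d / (norm x)\<^sup>2)\<^sup>2 * (norm x)\<^sup>2 = - (d\<^sup>2) / (norm x)\<^sup>2"
      by (simp add: field_simps power2_eq_square)
    with ineq[of "- d / (norm x)\<^sup>2"] have "0 \<le> - (d\<^sup>2) / (norm x)\<^sup>2" by simp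
    moreover have "d\<^sup>2 > 0" using d by simp
    ultimately show False using \<open>(norm x)\<^sup>2 > 0\<close> by (simp add: field_simps)
  qed
  have "f x = cinner x y" for x
  proof -
    have "Im (f x) = Im (cinner x y)"
      \<comment> \<open>Linearity recovers imaginary parts: \<open>Re (f (\<i> x)) = - Im (f x)\<close>.\<close>
      using Re_eq[of "scaleC \<i> x"] by (simp add: scale cinner_scaleC_left)
    with Re_eq[of x] show ?thesis by (simp add: complex_eq_iff)
  qed
  then show ?thesis by blast
qed

section \<open>Compact operators form a C*-algebra\<close>

text \<open>
  Total boundedness is easier to carry through sums, products, limits and adjoints than compactness of a
  closure, because finite nets can be combined explicitly. The centres of a net may lie outside the set.
\<close>

lemma compact_closure_iff_nets:
  fixes S :: "'a::complete_space set"
  shows "compact (closure S) \<longleftrightarrow> (\<forall>e>0. \<exists>k. finite k \<and> (\<forall>x\<in>S. \<exists>y\<in>k. dist x y < e))"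
proof
  assume "compact (closure S)"
  then have nets: "\<forall>e>0. \<exists>k. finite k \<and> closure S \<subseteq> (\<Union>x\<in>k. ball x e)"
    by (simp add: compact_eq_totally_bounded)
  show "\<forall>e>0. \<exists>k. finite k \<and> (\<forall>x\<in>S. \<exists>y\<in>k. dist x y < e)"
  proof (intro allI impI)
    fix e :: real assume "e > 0"
    with nets obtain k where k: "finite k" "closure S \<subseteq> (\<Union>x\<in>k. ball x e)" by blast
    have "\<exists>y\<in>k. dist x y < e" if "x \<in> S" for x
    proof -
      have "x \<in> (\<Union>x\<in>k. ball x e)" using that k(2) closure_subset by blast
      then show ?thesis by (auto simp: dist_commute)
    qed
    with k(1) show "\<exists>k. finite k \<and> (\<forall>x\<in>S. \<exists>y\<in>k. dist x y < e)" by blast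
  qed
next
  assume nets: "\<forall>e>0. \<exists>k. finite k \<and> (\<forall>x\<in>S. \<exists>y\<in>k. dist x y < e)"
  show "compact (closure S)"
    unfolding compact_eq_totally_bounded
  proof (intro conjI allI impI)
    show "complete (closure S)" by (simp add: complete_eq_closed)
    fix e :: real assume "e > 0"
    then have "e / 2 > 0" by simp
    with nets obtain k where k: "finite k" "\<forall>x\<in>S. \<exists>y\<in>k. dist x y < e / 2" by blast
    have "closure S \<subseteq> (\<Union>y\<in>k. cball y (e / 2))"
      using k by (intro closure_minimal closed_UN) (force simp: dist_commute)+
    also have "\<dots> \<subseteq> (\<Union>y\<in>k. ball y e)"
      using \<open>e > 0\<close> by (intro UN_mono) auto
    finally show "\<exists>k. finite k \<and> closure S \<subseteq> (\<Union>x\<in>k. ball x e)" using k(1) by blast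
  qed
qed

abbreviation clinear :: "('a::complex_inner \<Rightarrow> 'b::complex_inner) \<Rightarrow> bool" where
  "clinear \<equiv> Vector_Spaces.linear scaleC scaleC"

lemma clinear_iff:
  "clinear T \<longleftrightarrow> (\<forall>x y. T (x + y) = T x + T y) \<and> (\<forall>c x. T (scaleC c x) = scaleC c (T x))"
  by (simp add: Vector_Spaces.linear_iff vector_space_scaleC)

lemma clinear_imp_linear: "clinear T \<Longrightarrow> linear T"
  by (intro linearI) (simp_all add: clinear_iff flip: scaleC_of_real)

lemma clinear_bounded_linear:
  assumes "clinear T" "\<And>x. norm x \<le> 1 \<Longrightarrow> norm (T x) \<le> M"
  shows "bounded_linear T" "norm (T x) \<le> M * norm x" "onorm T \<le> M"
proof -
  have lin: "linear T" using assms(1) by (rule clinear_imp_linear)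
  have *: "norm (T x) \<le> M * norm x" for x
  proof (cases "x = 0")
    case True
    then show ?thesis using linear_0[OF lin] by simp
  next
    case False
    have "norm (T ((1 / norm x) *\<^sub>R x)) \<le> M"
      using False by (intro assms(2)) simp
    then show ?thesis
      using False by (simp add: linear_scale[OF lin] divide_simps)
  qed
  then show "norm (T x) \<le> M * norm x" .
  have "M \<ge> 0" using order_trans[OF norm_ge_zero assms(2), of 0] by simp
  then show "onorm T \<le> M" using * by (rule onorm_bound)
  show "bounded_linear T"
    using lin * by (intro bounded_linear_intro[where K = M])
      (simp_all add: linear_add linear_scale mult.commute)
qed

lemma compact_operators_carrier_iff:
  fixes T :: "'h::chilbert_space \<Rightarrow> 'h"
  shows "T \<in> carrier compact_operators \<longleftrightarrow> clinear T \<and>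
    (\<forall>e>0. \<exists>k. finite k \<and> (\<forall>x. norm x \<le> 1 \<longrightarrow> (\<exists>y\<in>k. norm (T x - y) < e)))"
  by (simp add: compact_operators_def compact_closure_iff_nets dist_norm) (simp add: Ball_def)

lemma compact_operator_clinear: "T \<in> carrier compact_operators \<Longrightarrow> clinear T"
  by (simp add: compact_operators_carrier_iff)

lemma compact_operator_net:
  assumes "T \<in> carrier compact_operators" "e > 0"
  obtains k where "finite k" "\<And>x. norm x \<le> 1 \<Longrightarrow> \<exists>y\<in>k. norm (T x - y) < e"
  using assms by (auto simp: compact_operators_carrier_iff)

lemma compact_operator_bounded_linear:
  assumes "T \<in> carrier compact_operators"
  shows "bounded_linear T"
proof -
  obtain k where k: "finite k" "\<And>x. norm x \<le> 1 \<Longrightarrow> \<exists>y\<in>k. norm (T x - y) < 1"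
    using compact_operator_net[OF assms zero_less_one] by blast
  have "norm (T x) \<le> 1 + (\<Sum>y\<in>k. norm y)" if x: "norm x \<le> 1" for x
  proof -
    obtain y where y: "y \<in> k" "norm (T x - y) < 1" using k(2)[OF x] by blast
    have "norm y \<le> (\<Sum>y\<in>k. norm y)" using y(1) k(1) by (simp add: member_le_sum)
    with y(2) norm_triangle_sub[of "T x" y] show ?thesis by linarith
  qed
  then show ?thesis by (rule clinear_bounded_linear(1)[OF compact_operator_clinear[OF assms]])
qed

text \<open>
  Compactness passes to norm limits: a net for a close operator is a net for the limit, with a slightly
  larger radius.
\<close>

lemma compact_operator_approx:
  fixes T :: "'h::chilbert_space \<Rightarrow> 'h"
  assumes "clinear T"
    and "\<And>e. e > 0 \<Longrightarrow> \<exists>S\<in>carrier compact_operators. \<forall>x. norm x \<le> 1 \<longrightarrow> norm (T x - S x) \<le> e"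
  shows "T \<in> carrier compact_operators"
  unfolding compact_operators_carrier_iff
proof (intro conjI allI impI)
  fix e :: real assume "e > 0"
  then have "e / 2 > 0" by simp
  then obtain S where S: "S \<in> carrier compact_operators" "\<And>x. norm x \<le> 1 \<Longrightarrow> norm (T x - S x) \<le> e / 2"
    using assms(2) by blast
  obtain k where k: "finite k" "\<And>x. norm x \<le> 1 \<Longrightarrow> \<exists>y\<in>k. norm (S x - y) < e / 2"
    using compact_operator_net[OF S(1) \<open>e / 2 > 0\<close>] by blast
  have "\<exists>y\<in>k. norm (T x - y) < e" if x: "norm x \<le> 1" for x
  proof -
    obtain y where "y \<in> k" "norm (S x - y) < e / 2" using k(2)[OF x] by blast
    moreover have "norm (T x - y) \<le> norm (T x - S x) + norm (S x - y)"
      using norm_triangle_ineq[of "T x - S x" "S x - y"] by simp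
    ultimately show ?thesis using S(2)[OF x] by (intro bexI[of _ y]) linarith+
  qed
  with k(1) show "\<exists>k. finite k \<and> (\<forall>x. norm x \<le> 1 \<longrightarrow> (\<exists>y\<in>k. norm (T x - y) < e))" by blast
qed (fact assms(1))

lemma compact_operator_zero: "(\<lambda>x. 0) \<in> carrier compact_operators"
  unfolding compact_operators_carrier_iff clinear_iff
  by (auto intro!: exI[of _ "{0}"])

lemma compact_operator_add:
  assumes "S \<in> carrier compact_operators" "T \<in> carrier compact_operators"
  shows "(\<lambda>x. S x + T x) \<in> carrier compact_operators"
  unfolding compact_operators_carrier_iff
proof (intro conjI allI impI)
  show "clinear (\<lambda>x. S x + T x)"
    using assms[THEN compact_operator_clinear] by (simp add: clinear_iff scaleC_add_right)
  fix e :: real assume "e > 0"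
  then have e: "e / 2 > 0" by simp
  obtain k where k: "finite k" "\<And>x. norm x \<le> 1 \<Longrightarrow> \<exists>y\<in>k. norm (S x - y) < e / 2"
    using compact_operator_net[OF assms(1) e] by blast
  obtain l where l: "finite l" "\<And>x. norm x \<le> 1 \<Longrightarrow> \<exists>y\<in>l. norm (T x - y) < e / 2"
    using compact_operator_net[OF assms(2) e] by blast
  have "\<exists>y\<in>(\<lambda>(y, z). y + z) ` (k \<times> l). norm (S x + T x - y) < e" if x: "norm x \<le> 1" for x
  proof -
    obtain y z where yz: "y \<in> k" "norm (S x - y) < e / 2" "z \<in> l" "norm (T x - z) < e / 2"
      using k(2)[OF x] l(2)[OF x] by blast
    then have "norm (S x + T x - (y + z)) < e"
      using norm_diff_triangle_ineq[of "S x" "T x" y z] by linarith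
    with yz show ?thesis by (intro bexI[of _ "y + z"]) auto
  qed
  with k(1) l(1) show "\<exists>k. finite k \<and> (\<forall>x. norm x \<le> 1 \<longrightarrow> (\<exists>y\<in>k. norm (S x + T x - y) < e))"
    by (intro exI[of _ "(\<lambda>(y, z). y + z) ` (k \<times> l)"]) blast
qed

lemma compact_operator_comp_left:
  fixes B T :: "'h::chilbert_space \<Rightarrow> 'h"
  assumes "clinear B" "bounded_linear B" "T \<in> carrier compact_operators"
  shows "B \<circ> T \<in> carrier compact_operators"
  unfolding compact_operators_carrier_iff
proof (intro conjI allI impI)
  show "clinear (B \<circ> T)"
    using assms(1) compact_operator_clinear[OF assms(3)] by (simp add: clinear_iff)
  obtain M where M: "M > 0" "\<And>x. norm (B x) \<le> norm x * M"
    using bounded_linear.pos_bounded[OF assms(2)] by blast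
  fix e :: real assume "e > 0"
  with M have e: "e / M > 0" by simp
  obtain k where k: "finite k" "\<And>x. norm x \<le> 1 \<Longrightarrow> \<exists>y\<in>k. norm (T x - y) < e / M"
    using compact_operator_net[OF assms(3) e] by blast
  have "\<exists>y\<in>B ` k. norm ((B \<circ> T) x - y) < e" if x: "norm x \<le> 1" for x
  proof -
    obtain y where y: "y \<in> k" "norm (T x - y) < e / M" using k(2)[OF x] by blast
    have "norm (B (T x) - B y) \<le> norm (T x - y) * M"
      using M(2)[of "T x - y"] linear_diff[OF bounded_linear.linear[OF assms(2)]] by simp
    also have "\<dots> < e" using y(2) M(1) by (simp add: field_simps)
    finally show ?thesis using y(1) by auto
  qed
  with k(1) show "\<exists>k. finite k \<and> (\<forall>x. norm x \<le> 1 \<longrightarrow> (\<exists>y\<in>k. norm ((B \<circ> T) x - y) < e))"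
    by (intro exI[of _ "B ` k"]) blast
qed

lemma compact_operator_comp_right:
  fixes B T :: "'h::chilbert_space \<Rightarrow> 'h"
  assumes "clinear B" "bounded_linear B" "T \<in> carrier compact_operators"
  shows "T \<circ> B \<in> carrier compact_operators"
  unfolding compact_operators_carrier_iff
proof (intro conjI allI impI)
  show "clinear (T \<circ> B)"
    using assms(1) compact_operator_clinear[OF assms(3)] by (simp add: clinear_iff)
  have lin: "linear T" "linear B"
    using assms compact_operator_clinear clinear_imp_linear by blast+
  obtain M where M: "M > 0" "\<And>x. norm (B x) \<le> norm x * M"
    using bounded_linear.pos_bounded[OF assms(2)] by blast
  fix e :: real assume "e > 0"
  with M have e: "e / M > 0" by simp
  obtain k where k: "finite k" "\<And>x. norm x \<le> 1 \<Longrightarrow> \<exists>y\<in>k. norm (T x - y) < e / M"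
    using compact_operator_net[OF assms(3) e] by blast
  have "\<exists>y\<in>scaleR M ` k. norm ((T \<circ> B) x - y) < e" if x: "norm x \<le> 1" for x
  proof -
    have "norm x * M \<le> M" using x M(1) by simp
    then have "norm (B x) \<le> M" using M(2)[of x] by linarith
    then have "norm ((1 / M) *\<^sub>R B x) \<le> 1" using M(1) by simp
    then obtain y where y: "y \<in> k" "norm (T ((1 / M) *\<^sub>R B x) - y) < e / M" using k(2) by blast
    have "T (B x) - M *\<^sub>R y = M *\<^sub>R (T ((1 / M) *\<^sub>R B x) - y)"
      using M(1) by (simp add: linear_scale[OF lin(1)] algebra_simps)
    then have "norm (T (B x) - M *\<^sub>R y) = M * norm (T ((1 / M) *\<^sub>R B x) - y)"
      using M(1) by simp
    also have "\<dots> < e" using y(2) M(1) by (simp add: field_simps)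
    finally show ?thesis using y(1) by auto
  qed
  with k(1) show "\<exists>k. finite k \<and> (\<forall>x. norm x \<le> 1 \<longrightarrow> (\<exists>y\<in>k. norm ((T \<circ> B) x - y) < e))"
    by (intro exI[of _ "scaleR M ` k"]) blast
qed

lemma clinear_scaleC: "clinear (scaleC c)"
  by (simp add: clinear_iff scaleC_add_right scaleC_scaleC mult.commute)

lemma compact_operator_scale:
  assumes "T \<in> carrier compact_operators"
  shows "(\<lambda>x. scaleC c (T x)) \<in> carrier compact_operators"
  using compact_operator_comp_left[OF clinear_scaleC bounded_linear_scaleC assms, of c]
  by (simp add: comp_def)

text \<open>
  For fixed \<open>y\<close> the map \<open>x \<mapsto> cinner (T x) y\<close> is a bounded functional; its Riesz vector is the value of the
  adjoint at \<open>y\<close>.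
\<close>

lemma adjoint_exists:
  fixes T :: "'h::chilbert_space \<Rightarrow> 'h"
  assumes "clinear T" "bounded_linear T"
  shows "\<exists>S. \<forall>x y. cinner (T x) y = cinner x (S y)"
proof -
  have "\<exists>z. \<forall>x. cinner (T x) y = cinner x z" for y
  proof (rule Riesz_representation)
    show "cmod (cinner (T x) y) \<le> (onorm T * norm y) * norm x" for x
    proof -
      have "norm (T x) * norm y \<le> (onorm T * norm x) * norm y"
        by (intro mult_right_mono onorm[OF assms(2)]) simp
      with cinner_Cauchy_Schwarz[of "T x" y] show ?thesis by (simp add: mult_ac)
    qed
  qed (use assms(1) in \<open>simp_all add: clinear_iff cinner_add_left cinner_scaleC_left\<close>)
  then show ?thesis by metis
qed

lemma adjoint_op_eqI:
  assumes "\<And>x y. cinner (T x) y = cinner x (S y)"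
  shows "adjoint_op T = S"
  unfolding adjoint_op_def
proof (rule the_equality)
  show "S' = S" if "\<forall>x y. cinner (T x) y = cinner x (S' y)" for S'
    using that assms by (intro ext cinner_eqI) metis
qed (use assms in blast)

lemma cinner_adjoint_op:
  assumes "clinear T" "bounded_linear T"
  shows "cinner (T x) y = cinner x (adjoint_op T y)"
  using adjoint_exists[OF assms] adjoint_op_eqI by metis

lemma cinner_adjoint_op':
  assumes "clinear T" "bounded_linear T"
  shows "cinner (adjoint_op T x) y = cinner x (T y)"
  by (metis cinner_adjoint_op[OF assms] cinner_commute)

lemma adjoint_op_clinear:
  assumes "clinear T" "bounded_linear T"
  shows "clinear (adjoint_op T)"
  unfolding clinear_iff
  by (intro conjI allI cinner_eqI)
    (simp_all add: cinner_add_right cinner_scaleC_right flip: cinner_adjoint_op[OF assms])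

lemma adjoint_op_norm_le:
  assumes "clinear T" "bounded_linear T"
  shows "norm (adjoint_op T y) \<le> onorm T * norm y"
proof (cases "adjoint_op T y = 0")
  case True
  then show ?thesis using onorm_pos_le[OF assms(2)] by simp
next
  case False
  let ?z = "adjoint_op T y"
  have "(norm ?z)\<^sup>2 = cmod (cinner (T ?z) y)"
    by (simp only: cinner_adjoint_op[OF assms] cinner_self norm_of_real) simp
  also have "\<dots> \<le> norm (T ?z) * norm y" by (rule cinner_Cauchy_Schwarz)
  also have "\<dots> \<le> (onorm T * norm ?z) * norm y"
    by (intro mult_right_mono onorm[OF assms(2)]) simp
  finally show ?thesis using False by (simp add: power2_eq_square mult_ac)
qed

lemma adjoint_op_bounded_linear:
  assumes "clinear T" "bounded_linear T"
  shows "bounded_linear (adjoint_op T)"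
  using adjoint_op_norm_le[OF assms] linear_add[OF clinear_imp_linear[OF adjoint_op_clinear[OF assms]]]
    linear_scale[OF clinear_imp_linear[OF adjoint_op_clinear[OF assms]]]
  by (intro bounded_linear_intro[where K = "onorm T"]) (simp_all add: mult.commute)

text \<open>
  Schauder's theorem. Writing \<open>A\<close> for the adjoint,
  \<open>\<parallel>A y - A z\<parallel>\<^sup>2 = \<langle>T A (y - z), y - z\<rangle> \<le> 2 \<parallel>T A y - T A z\<parallel>\<close> on the unit ball, and \<open>T A\<close> is compact. Hence a
  finite net for \<open>T A\<close>, once its centres are replaced by points of the image, yields a net for \<open>A\<close>.
\<close>

lemma compact_operator_adjoint:
  fixes T :: "'h::chilbert_space \<Rightarrow> 'h"
  assumes T: "T \<in> carrier compact_operators"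
  shows "adjoint_op T \<in> carrier compact_operators"
  unfolding compact_operators_carrier_iff
proof (intro conjI allI impI)
  note lin = compact_operator_clinear[OF T] compact_operator_bounded_linear[OF T]
  let ?A = "adjoint_op T"
  show A: "clinear ?A" by (rule adjoint_op_clinear[OF lin])
  have TA: "T \<circ> ?A \<in> carrier compact_operators"
    by (rule compact_operator_comp_right[OF A adjoint_op_bounded_linear[OF lin] T])
  have contr: "(norm (?A y - ?A z))\<^sup>2 \<le> 2 * norm (T (?A y) - T (?A z))"
    if "norm y \<le> 1" "norm z \<le> 1" for y z
  proof -
    have "?A y - ?A z = ?A (y - z)" "T (?A y) - T (?A z) = T (?A (y - z))"
      by (simp_all add: linear_diff[OF clinear_imp_linear] lin(1) A)
    then have "(norm (?A y - ?A z))\<^sup>2 = cmod (cinner (T (?A y) - T (?A z)) (y - z))"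
      by (simp only: cinner_adjoint_op[OF lin] cinner_self norm_of_real) simp
    also have "\<dots> \<le> norm (T (?A y) - T (?A z)) * norm (y - z)" by (rule cinner_Cauchy_Schwarz)
    also have "\<dots> \<le> norm (T (?A y) - T (?A z)) * 2"
      using norm_triangle_ineq4[of y z] that by (intro mult_left_mono) auto
    finally show ?thesis by simp
  qed
  fix e :: real assume "e > 0"
  then have "e\<^sup>2 / 4 > 0" by simp
  obtain k where k: "finite k" "\<And>x. norm x \<le> 1 \<Longrightarrow> \<exists>y\<in>k. norm ((T \<circ> ?A) x - y) < e\<^sup>2 / 4"
    using compact_operator_net[OF TA \<open>e\<^sup>2 / 4 > 0\<close>] by blast
  \<comment> \<open>A preimage in the unit ball of a point near the centre \<open>c\<close>, where one exists.\<close>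
  define p where "p c = (SOME x. norm x \<le> 1 \<and> norm ((T \<circ> ?A) x - c) < e\<^sup>2 / 4)" for c
  have "\<exists>y\<in>(?A \<circ> p) ` k. norm (?A x - y) < e" if x: "norm x \<le> 1" for x
  proof -
    obtain c where c: "c \<in> k" "norm ((T \<circ> ?A) x - c) < e\<^sup>2 / 4" using k(2)[OF x] by blast
    with x have p: "norm (p c) \<le> 1" "norm ((T \<circ> ?A) (p c) - c) < e\<^sup>2 / 4"
      unfolding p_def by (metis (mono_tags, lifting) someI_ex)+
    have "(norm (?A x - ?A (p c)))\<^sup>2 \<le> 2 * norm (T (?A x) - T (?A (p c)))"
      using contr x p(1) by blast
    also have "\<dots> < e\<^sup>2"
      using norm_triangle_ineq4[of "(T \<circ> ?A) x - c" "(T \<circ> ?A) (p c) - c"] c(2) p(2) by simp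
    finally have "norm (?A x - ?A (p c)) < e"
      using \<open>e > 0\<close> by (simp add: power2_less_imp_less)
    with c(1) show ?thesis by auto
  qed
  with k(1) show "\<exists>k. finite k \<and> (\<forall>x. norm x \<le> 1 \<longrightarrow> (\<exists>y\<in>k. norm (?A x - y) < e))"
    by (intro exI[of _ "(?A \<circ> p) ` k"]) blast
qed

text \<open>
  The C*-identity: \<open>\<parallel>T x\<parallel>\<^sup>2 = \<langle>x, T* T x\<rangle>\<close> bounds \<open>\<parallel>T\<parallel>\<^sup>2\<close> by \<open>\<parallel>T* T\<parallel>\<close>, and \<open>\<parallel>T*\<parallel> \<le> \<parallel>T\<parallel>\<close> gives the other
  inequality.
\<close>

lemma onorm_adjoint_op_comp:
  fixes T :: "'h::chilbert_space \<Rightarrow> 'h"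
  assumes "clinear T" "bounded_linear T"
  shows "onorm (adjoint_op T \<circ> T) = (onorm T)\<^sup>2"
proof (rule antisym)
  note T = assms
  note A = adjoint_op_bounded_linear[OF T]
  have "onorm (adjoint_op T) \<le> onorm T"
    using adjoint_op_norm_le[OF T] by (intro onorm_bound onorm_pos_le T)
  then show "onorm (adjoint_op T \<circ> T) \<le> (onorm T)\<^sup>2"
    using onorm_compose[OF A T(2)] mult_right_mono[OF _ onorm_pos_le[OF T(2)]]
    unfolding power2_eq_square by (meson order_trans)
  have AT: "bounded_linear (adjoint_op T \<circ> T)"
    using bounded_linear_compose[OF A T(2)] by (simp add: comp_def)
  have "(norm (T x))\<^sup>2 \<le> onorm (adjoint_op T \<circ> T) * (norm x)\<^sup>2" for x
  proof -
    have "(norm (T x))\<^sup>2 = cmod (cinner x ((adjoint_op T \<circ> T) x))"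
      by (simp only: comp_apply cinner_adjoint_op[OF T, symmetric] cinner_self norm_of_real) simp
    also have "\<dots> \<le> norm x * norm ((adjoint_op T \<circ> T) x)" by (rule cinner_Cauchy_Schwarz)
    also have "\<dots> \<le> norm x * (onorm (adjoint_op T \<circ> T) * norm x)"
      by (intro mult_left_mono onorm[OF AT]) simp
    finally show ?thesis by (simp add: power2_eq_square mult_ac)
  qed
  then have "norm (T x) \<le> sqrt (onorm (adjoint_op T \<circ> T)) * norm x" for x
    by (metis norm_ge_zero real_sqrt_abs real_sqrt_le_mono real_sqrt_mult abs_of_nonneg)
  then have "onorm T \<le> sqrt (onorm (adjoint_op T \<circ> T))"
    by (intro onorm_bound) (simp_all add: onorm_pos_le[OF AT])
  then show "(onorm T)\<^sup>2 \<le> onorm (adjoint_op T \<circ> T)"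
    using onorm_pos_le[OF AT] onorm_pos_le[OF T(2)]
    by (metis power_mono real_sqrt_pow2)
qed

text \<open>
  A limit exists in the Banach space of bounded linear maps; it is complex linear as a pointwise limit
  and compact as a norm limit of compact operators.
\<close>

lemma compact_operators_complete:
  fixes s :: "nat \<Rightarrow> 'h::chilbert_space \<Rightarrow> 'h"
  assumes s: "\<And>n. s n \<in> carrier compact_operators"
    and Cauchy: "\<And>e. e > 0 \<Longrightarrow> \<exists>N. \<forall>m\<ge>N. \<forall>n\<ge>N. onorm (\<lambda>x. s m x - s n x) < e"
  shows "\<exists>T\<in>carrier compact_operators. (\<lambda>n. onorm (\<lambda>x. s n x - T x)) \<longlonglongrightarrow> 0"
proof -
  have bl: "bounded_linear (s n)" for n by (rule compact_operator_bounded_linear[OF s])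
  define b where "b n = Blinfun (s n)" for n
  have b: "blinfun_apply (b n) = s n" for n
    unfolding b_def by (rule bounded_linear_Blinfun_apply[OF bl])
  have nd: "norm (b m - L) = onorm (\<lambda>x. s m x - blinfun_apply L x)" for m L
    by (simp add: norm_blinfun.rep_eq minus_blinfun.rep_eq b)
  have "Cauchy b"
    using Cauchy by (intro metric_CauchyI) (simp add: dist_norm nd b)
  then obtain L where L: "b \<longlonglongrightarrow> L" using Cauchy_convergent convergent_def by blast
  let ?T = "blinfun_apply L"
  have lim: "(\<lambda>n. onorm (\<lambda>x. s n x - ?T x)) \<longlonglongrightarrow> 0"
    using L by (simp add: LIM_zero_iff tendsto_norm_zero_iff flip: nd)
  have pt: "(\<lambda>n. s n x) \<longlonglongrightarrow> ?T x" for x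
    using bounded_linear.tendsto[OF bounded_linear_apply_blinfun L, of x] by (simp add: b)
  have "clinear ?T"
    unfolding clinear_iff
  proof (intro conjI allI)
    fix c x
    have "(\<lambda>n. s n (scaleC c x)) \<longlonglongrightarrow> scaleC c (?T x)"
      using tendsto_scaleC_right[OF pt, of c x] compact_operator_clinear[OF s] by (simp add: clinear_iff)
    then show "?T (scaleC c x) = scaleC c (?T x)" using pt LIMSEQ_unique by blast
  qed (simp add: blinfun.add_right)
  moreover have "\<exists>S\<in>carrier compact_operators. \<forall>x. norm x \<le> 1 \<longrightarrow> norm (?T x - S x) \<le> e" if "e > 0" for e
  proof -
    obtain n where n: "norm (b n - L) < e"
      using metric_LIMSEQ_D[OF L \<open>e > 0\<close>] by (auto simp: dist_norm)
    have "norm (?T x - s n x) \<le> e" if "norm x \<le> 1" for x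
    proof -
      have "norm (?T x - s n x) = norm (blinfun_apply (b n - L) x)"
        by (simp add: minus_blinfun.rep_eq b norm_minus_commute)
      also have "\<dots> \<le> norm (b n - L) * norm x" by (rule norm_blinfun)
      also have "\<dots> \<le> norm (b n - L) * 1" using that by (intro mult_left_mono) auto
      finally show ?thesis using n by simp
    qed
    then show ?thesis using s by blast
  qed
  ultimately have "?T \<in> carrier compact_operators" by (rule compact_operator_approx)
  with lim show ?thesis by blast
qed

lemma cdiff_compact_operators: "cdiff compact_operators S T = (\<lambda>x. S x - T x)"
  by (simp add: cdiff_def compact_operators_def)

lemma compact_operators_simps:
  "czero compact_operators = (\<lambda>x. 0)"
  "cadd compact_operators S T = (\<lambda>x. S x + T x)"
  "cscale compact_operators c T = (\<lambda>x. scaleC c (T x))"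
  "cmult compact_operators S T = S \<circ> T"
  "cstar compact_operators = adjoint_op"
  "cnorm compact_operators = onorm"
  by (simp_all add: compact_operators_def)

lemma onorm_scaleC:
  assumes "bounded_linear T"
  shows "onorm (\<lambda>x. scaleC c (T x)) = cmod c * onorm T"
proof -
  have le: "onorm (\<lambda>x. scaleC c (S x)) \<le> cmod c * onorm S" if S: "bounded_linear S" for c S
    using onorm[OF S] onorm_pos_le[OF S]
    by (intro onorm_bound) (simp_all add: norm_scaleC mult.assoc mult_left_mono)
  show ?thesis
  proof (cases "c = 0")
    case True
    then show ?thesis by (simp add: onorm_zero)
  next
    case False
    have cT: "bounded_linear (\<lambda>x. scaleC c (T x))"
      by (rule bounded_linear_compose[OF bounded_linear_scaleC assms])
    from le[OF cT, of "inverse c"] False have "onorm T \<le> inverse (cmod c) * onorm (\<lambda>x. scaleC c (T x))"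
      by (simp add: scaleC_scaleC norm_inverse)
    then have "cmod c * onorm T \<le> onorm (\<lambda>x. scaleC c (T x))"
      using False by (simp add: field_simps)
    with le[OF assms, of c] show ?thesis by simp
  qed
qed

theorem cstar_algebra_compact_operators:
  "cstar_algebra (compact_operators :: ('h::chilbert_space \<Rightarrow> 'h) cstar_record)"
proof -
  note simps = compact_operators_simps cdiff_compact_operators
  note lin = compact_operator_clinear compact_operator_bounded_linear
  have adj: "cinner (T x) y = cinner x (adjoint_op T y)"
    "cinner (adjoint_op T x) y = cinner x (T y)"
    if "T \<in> carrier compact_operators" for T :: "'h \<Rightarrow> 'h" and x y
    using cinner_adjoint_op[OF lin[OF that]] cinner_adjoint_op'[OF lin[OF that]] by blast+
  show ?thesis
  proof (unfold_locales, unfold simps)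
    fix x y z :: "'h \<Rightarrow> 'h" and c d :: complex
    assume x: "x \<in> carrier compact_operators"
    note xl = lin[OF x]
    show "(\<lambda>v. scaleC c (x v)) \<in> carrier compact_operators" by (rule compact_operator_scale[OF x])
    show "adjoint_op x \<in> carrier compact_operators" by (rule compact_operator_adjoint[OF x])
    show "adjoint_op (adjoint_op x) = x" by (rule adjoint_op_eqI) (simp add: adj[OF x])
    show "adjoint_op (\<lambda>v. scaleC c (x v)) = (\<lambda>v. scaleC (cnj c) (adjoint_op x v))"
      by (rule adjoint_op_eqI) (simp add: adj[OF x] cinner_scaleC_left cinner_scaleC_right)
    show "onorm x \<ge> 0" by (rule onorm_pos_le[OF xl(2)])
    show "onorm x = 0 \<longleftrightarrow> x = (\<lambda>v. 0)" using onorm_eq_0[OF xl(2)] by auto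
    show "onorm (\<lambda>v. scaleC c (x v)) = cmod c * onorm x" by (rule onorm_scaleC[OF xl(2)])
    show "onorm (adjoint_op x \<circ> x) = (onorm x)\<^sup>2" by (rule onorm_adjoint_op_comp[OF xl])
    show "(\<lambda>v. scaleC (c + d) (x v)) = (\<lambda>v. scaleC c (x v) + scaleC d (x v))"
      by (simp add: scaleC_add_left)
    assume y: "y \<in> carrier compact_operators"
    note yl = lin[OF y]
    show "(\<lambda>v. x v + y v) \<in> carrier compact_operators" by (rule compact_operator_add[OF x y])
    show "x \<circ> y \<in> carrier compact_operators" by (rule compact_operator_comp_left[OF xl y])
    show "adjoint_op (\<lambda>v. x v + y v) = (\<lambda>v. adjoint_op x v + adjoint_op y v)"
      by (rule adjoint_op_eqI) (simp add: adj[OF x] adj[OF y] cinner_add_left cinner_add_right)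
    show "adjoint_op (x \<circ> y) = adjoint_op y \<circ> adjoint_op x"
      by (rule adjoint_op_eqI) (simp add: adj[OF x] adj[OF y])
    show "onorm (\<lambda>v. x v + y v) \<le> onorm x + onorm y" by (rule onorm_triangle[OF xl(2) yl(2)])
    show "onorm (x \<circ> y) \<le> onorm x * onorm y" by (rule onorm_compose[OF xl(2) yl(2)])
    show "x \<circ> (\<lambda>v. scaleC c (y v)) = (\<lambda>v. scaleC c ((x \<circ> y) v))"
      using xl(1) by (simp add: clinear_iff fun_eq_iff)
    show "x \<circ> (\<lambda>v. y v + z v) = (\<lambda>v. (x \<circ> y) v + (x \<circ> z) v)"
      using xl(1) by (simp add: clinear_iff fun_eq_iff)
  next
    show "(\<lambda>x. 0 :: 'h) \<in> carrier compact_operators" by (rule compact_operator_zero)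
  next
    fix s :: "nat \<Rightarrow> 'h \<Rightarrow> 'h"
    assume "\<And>n. s n \<in> carrier compact_operators"
      "\<And>e. e > 0 \<Longrightarrow> \<exists>N. \<forall>m\<ge>N. \<forall>n\<ge>N. onorm (\<lambda>x. s m x - s n x) < e"
    then show "\<exists>x\<in>carrier compact_operators. (\<lambda>n. onorm (\<lambda>xa. s n xa - x xa)) \<longlonglongrightarrow> 0"
      by (rule compact_operators_complete)
  qed (auto simp: fun_eq_iff scaleC_add_right scaleC_scaleC add_ac)
qed

section \<open>States of C*-algebras and weakly-uniform limits\<close>

context cstar_algebra
begin

lemma scale_zero: "x \<in> carrier A \<Longrightarrow> cscale A 0 x = czero A"
  using scale_add_left[of x 1 "-1"] scale_one[of x] diff_self[of x] by (simp add: cdiff_def)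

lemma diff_closed: "x \<in> carrier A \<Longrightarrow> y \<in> carrier A \<Longrightarrow> cdiff A x y \<in> carrier A"
  by (simp add: cdiff_def add_closed scale_closed)

lemma mult_zero_left: "x \<in> carrier A \<Longrightarrow> cmult A (czero A) x = czero A"
  using mult_scale_left[of x x 0] by (simp add: scale_zero mult_closed)

lemma mult_zero_right: "x \<in> carrier A \<Longrightarrow> cmult A x (czero A) = czero A"
  using mult_scale_right[of x x 0] by (simp add: scale_zero mult_closed)

lemma star_zero: "cstar A (czero A) = czero A"
  using star_scale[of "czero A" 0] by (simp add: scale_zero zero_closed star_closed)

lemma norm_zero: "cnorm A (czero A) = 0"
  using norm_zero_iff zero_closed by blast

lemma zero_in_unit_ball: "czero A \<in> unit_ball A"
  by (simp add: unit_ball_def zero_closed norm_zero)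

lemma state_add:
  "\<phi> \<in> state_space A \<Longrightarrow> x \<in> carrier A \<Longrightarrow> y \<in> carrier A \<Longrightarrow> \<phi> (cadd A x y) = \<phi> x + \<phi> y"
  by (simp add: state_space_def bounded_functional_def)

lemma state_scale: "\<phi> \<in> state_space A \<Longrightarrow> x \<in> carrier A \<Longrightarrow> \<phi> (cscale A c x) = c * \<phi> x"
  by (simp add: state_space_def bounded_functional_def)

lemma state_diff:
  "\<phi> \<in> state_space A \<Longrightarrow> x \<in> carrier A \<Longrightarrow> y \<in> carrier A \<Longrightarrow> \<phi> (cdiff A x y) = \<phi> x - \<phi> y"
  by (simp add: cdiff_def state_add state_scale scale_closed)

lemma state_zero: "\<phi> \<in> state_space A \<Longrightarrow> \<phi> (czero A) = 0"
  using state_scale[of \<phi> "czero A" 0] by (simp add: scale_zero zero_closed)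

lemma state_nonneg:
  "\<phi> \<in> state_space A \<Longrightarrow> x \<in> carrier A \<Longrightarrow> \<phi> (cmult A (cstar A x) x) \<in> \<real>\<^sub>\<ge>\<^sub>0"
  by (simp add: state_space_def)

lemma state_bdd_above:
  assumes "\<phi> \<in> state_space A"
  shows "bdd_above ((\<lambda>x. cmod (\<phi> x)) ` unit_ball A)"
proof -
  obtain M where M: "\<And>x. x \<in> carrier A \<Longrightarrow> cmod (\<phi> x) \<le> M * cnorm A x"
    using assms unfolding state_space_def bounded_functional_def by blast
  have "cmod (\<phi> x) \<le> \<bar>M\<bar>" if "x \<in> unit_ball A" for x
  proof -
    have x: "x \<in> carrier A" "cnorm A x \<le> 1" using that by (auto simp: unit_ball_def)
    have "M * cnorm A x \<le> \<bar>M\<bar> * 1"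
      using x norm_nonneg[OF x(1)] by (intro mult_mono) auto
    with M[OF x(1)] show ?thesis by simp
  qed
  then show ?thesis by (auto intro!: bdd_aboveI2)
qed

lemma state_norm_le:
  assumes "\<phi> \<in> state_space A" "x \<in> carrier A"
  shows "cmod (\<phi> x) \<le> cnorm A x"
proof (cases "cnorm A x = 0")
  case True
  then have "x = czero A" using norm_zero_iff[OF assms(2)] by simp
  then show ?thesis using state_zero[OF assms(1)] norm_zero by simp
next
  case False
  with norm_nonneg[OF assms(2)] have pos: "cnorm A x > 0" by simp
  let ?y = "cscale A (of_real (1 / cnorm A x)) x"
  have "?y \<in> unit_ball A"
    using pos assms(2) by (simp add: unit_ball_def scale_closed norm_scale norm_divide)
  then have "cmod (\<phi> ?y) \<le> functional_norm A \<phi>"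
    unfolding functional_norm_def by (intro cSUP_upper state_bdd_above assms(1))
  also have "\<dots> = 1" using assms(1) by (simp add: state_space_def)
  finally show ?thesis
    using pos by (simp add: state_scale[OF assms] norm_mult norm_divide field_simps)
qed

text \<open>
  The supremum defining the functional norm is taken over a nonempty bounded set, so its value \<open>1\<close> for a
  state really is approached.
\<close>

lemma state_norm_approx:
  assumes "\<phi> \<in> state_space A" "d > 0"
  obtains x where "x \<in> carrier A" "cnorm A x \<le> 1" "cmod (\<phi> x) > 1 - d"
proof -
  have "1 - d < (SUP x\<in>unit_ball A. cmod (\<phi> x))"
    using assms by (simp add: state_space_def functional_norm_def)
  then obtain x where "x \<in> unit_ball A" "1 - d < cmod (\<phi> x)"
    using less_cSUP_iff[OF _ state_bdd_above[OF assms(1)]] zero_in_unit_ball by blast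
  with that show thesis by (auto simp: unit_ball_def)
qed

text \<open>
  Positivity of \<open>\<phi>\<close> on the elements \<open>(x + c y)* (x + c y)\<close>, expanded in \<open>c\<close>.
\<close>

lemma state_Cauchy_Schwarz:
  assumes "\<phi> \<in> state_space A" "x \<in> carrier A" "y \<in> carrier A"
  shows "(cmod (\<phi> (cmult A (cstar A x) y)))\<^sup>2
    \<le> Re (\<phi> (cmult A (cstar A x) x)) * Re (\<phi> (cmult A (cstar A y) y))"
proof (rule psd_form_bound(2))
  note cl = assms(2,3) add_closed scale_closed mult_closed star_closed
  fix c
  let ?z = "cadd A x (cscale A c y)"
  have "\<phi> (cmult A (cstar A ?z) ?z)
     = \<phi> (cmult A (cstar A x) x) + c * \<phi> (cmult A (cstar A x) y)
        + cnj c * \<phi> (cmult A (cstar A y) x) + (c * cnj c) * \<phi> (cmult A (cstar A y) y)"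
    by (simp add: cl star_add star_scale mult_add_left mult_add_right mult_scale_left
        mult_scale_right state_add[OF assms(1)] state_scale[OF assms(1)] algebra_simps)
  with state_nonneg[OF assms(1), of ?z]
  show "\<phi> (cmult A (cstar A x) x) + c * \<phi> (cmult A (cstar A x) y)
        + cnj c * \<phi> (cmult A (cstar A y) x) + (c * cnj c) * \<phi> (cmult A (cstar A y) y) \<in> \<real>\<^sub>\<ge>\<^sub>0"
    by (simp add: cl)
qed (use state_nonneg assms in blast)+

text \<open>
  By the C*-identity the norm of a projection is idempotent.
\<close>

lemma projection_norm_le_one:
  assumes "p \<in> carrier A" "cstar A p = p" "cmult A p p = p"
  shows "cnorm A p \<le> 1"
  using norm_star_mult_self[OF assms(1)] norm_nonneg[OF assms(1)] assms(2,3)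
  by (simp add: power2_eq_square) (metis mult_cancel_right1 order.refl zero_le_one)

lemma state_mem_of_compactin:
  "compactin (weak_star_topology A) K \<Longrightarrow> \<phi> \<in> K \<Longrightarrow> \<phi> \<in> state_space A"
  using compactin_subset_topspace by (fastforce simp: weak_star_topology_def)

lemma state_seminorm_upper:
  assumes "compactin (weak_star_topology A) K" "\<phi> \<in> K" "a \<in> carrier A"
  shows "cmod (\<phi> a) \<le> state_seminorm K a"
proof -
  have "bdd_above ((\<lambda>\<phi>. cmod (\<phi> a)) ` K)"
    using state_norm_le state_mem_of_compactin assms by (intro bdd_aboveI2) blast
  with assms(2) show ?thesis
    by (auto simp: state_seminorm_def intro!: cSUP_upper)
qed

lemma state_seminorm_least:
  assumes "r \<ge> 0" "\<And>\<phi>. \<phi> \<in> K \<Longrightarrow> cmod (\<phi> a) \<le> r"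
  shows "state_seminorm K a \<le> r"
  using assms by (auto simp: state_seminorm_def intro!: cSUP_least)

lemma state_seminorm_nonneg:
  assumes "compactin (weak_star_topology A) K" "a \<in> carrier A"
  shows "state_seminorm K a \<ge> 0"
  using state_seminorm_upper[OF assms(1) _ assms(2)] norm_ge_zero order_trans
  by (cases "K = {}") (simp add: state_seminorm_def, blast)

lemma openin_wu_seminorm_ball:
  assumes "compactin (weak_star_topology A) K" "a \<in> carrier A" "r > 0"
  shows "openin (wu_topology A) {b \<in> carrier A. state_seminorm K (cdiff A b a) < r}"
  unfolding wu_topology_def using assms by (intro topology_generated_by_Basis) blast

lemma continuous_map_weak_star_eval:
  "a \<in> carrier A \<Longrightarrow> continuous_map (weak_star_topology A) euclidean (\<lambda>\<phi>. \<phi> a)"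
  unfolding weak_star_topology_def
  by (intro continuous_map_from_subtopology continuous_map_product_projection)

text \<open>
  Subbasic open sets are balls around arbitrary centres \<open>a\<close>. When such a ball contains \<open>0\<close>, the triangle
  inequality for the seminorm shows that it contains every element of sufficiently small seminorm.
\<close>

lemma limitin_wu_zero:
  assumes closed: "\<And>n. x n \<in> carrier A"
    and unif: "\<And>K r. compactin (weak_star_topology A) K \<Longrightarrow> r > 0 \<Longrightarrow>
      \<forall>\<^sub>F n in sequentially. \<forall>\<phi>\<in>K. cmod (\<phi> (x n)) \<le> r"
  shows "limitin (wu_topology A) x (czero A) sequentially"
  unfolding limitin_def
proof (intro conjI allI impI)
  have "openin (wu_topology A) {b \<in> carrier A. state_seminorm {} (cdiff A b (czero A)) < 1}"
    by (intro openin_wu_seminorm_ball) (simp_all add: zero_closed)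
  from openin_subset[OF this] show "czero A \<in> topspace (wu_topology A)"
    by (auto simp: state_seminorm_def zero_closed)
  let ?B = "{{b \<in> carrier A. state_seminorm K (cdiff A b a) < r} | K a r.
        compactin (weak_star_topology A) K \<and> a \<in> carrier A \<and> r > 0}"
  fix U assume U: "openin (wu_topology A) U \<and> czero A \<in> U"
  then have "generate_topology_on ?B U"
    unfolding wu_topology_def by (simp add: openin_topology_generated_by_iff)
  moreover have "czero A \<in> U" using U by blast
  ultimately show "\<forall>\<^sub>F n in sequentially. x n \<in> U"
  proof (induction rule: generate_topology_on.induct)
    case Empty
    then show ?case by simp
  next
    case (Int a b)
    then show ?case by (simp add: eventually_conj)
  next
    case (UN \<U>)
    then obtain V where "V \<in> \<U>" "czero A \<in> V" by blast
    with UN.IH have "\<forall>\<^sub>F n in sequentially. x n \<in> V" by blast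
    then show ?case by (rule eventually_mono) (use \<open>V \<in> \<U>\<close> in blast)
  next
    case (Basis s)
    then obtain K a r where s: "s = {b \<in> carrier A. state_seminorm K (cdiff A b a) < r}"
      and K: "compactin (weak_star_topology A) K" and a: "a \<in> carrier A" by blast
    \<comment> \<open>The gap between the radius and the distance from \<open>0\<close> to the centre.\<close>
    define d where "d = r - state_seminorm K (cdiff A (czero A) a)"
    have "d / 2 > 0" using Basis.prems by (simp add: s d_def)
    from unif[OF K this] show ?case
    proof (rule eventually_mono)
      fix n assume n: "\<forall>\<phi>\<in>K. cmod (\<phi> (x n)) \<le> d / 2"
      have "state_seminorm K (cdiff A (x n) a) \<le> d / 2 + state_seminorm K (cdiff A (czero A) a)"
      proof (rule state_seminorm_least)
        show "0 \<le> d / 2 + state_seminorm K (cdiff A (czero A) a)"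
          using \<open>d / 2 > 0\<close> state_seminorm_nonneg[OF K diff_closed[OF zero_closed a]] by linarith
        fix \<phi> assume \<phi>: "\<phi> \<in> K"
        note st = state_mem_of_compactin[OF K \<phi>]
        have "cmod (\<phi> (cdiff A (x n) a)) = cmod (\<phi> (x n) + \<phi> (cdiff A (czero A) a))"
          by (simp add: state_diff[OF st] closed a zero_closed state_zero[OF st])
        also have "\<dots> \<le> cmod (\<phi> (x n)) + cmod (\<phi> (cdiff A (czero A) a))" by (rule norm_triangle_ineq)
        also have "\<dots> \<le> d / 2 + state_seminorm K (cdiff A (czero A) a)"
          using n \<phi> state_seminorm_upper[OF K \<phi> diff_closed[OF zero_closed a]] by (intro add_mono) auto
        finally show "cmod (\<phi> (cdiff A (x n) a)) \<le> \<dots>" .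
      qed
      also have "\<dots> < r" using \<open>d / 2 > 0\<close> unfolding d_def by argo
      finally show "x n \<in> s" by (simp add: s closed)
    qed
  qed
qed

end

section \<open>Matrix units obstruct joint continuity\<close>

primrec unit_sum :: "'a cstar_record \<Rightarrow> (nat \<Rightarrow> nat \<Rightarrow> 'a) \<Rightarrow> nat \<Rightarrow> 'a" where
  "unit_sum A e 0 = czero A"
| "unit_sum A e (Suc n) = cadd A (unit_sum A e n) (e n n)"

text \<open>
  An infinite system of matrix units whose diagonal sums form an approximate unit. The state \<open>\<omega>\<close> certifies
  that \<open>e 0 0\<close> can be told apart from \<open>0\<close> by a weakly-uniform neighbourhood.
\<close>

locale cstar_matrix_units = cstar_algebra A for A :: "'a cstar_record" +
  fixes e :: "nat \<Rightarrow> nat \<Rightarrow> 'a" and \<omega> :: "'a \<Rightarrow> complex"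
  assumes unit_closed: "e i j \<in> carrier A"
    and unit_mult: "cmult A (e i j) (e k l) = (if j = k then e i l else czero A)"
    and unit_star: "cstar A (e i j) = e j i"
    and approximate_unit: "x \<in> carrier A \<Longrightarrow>
      (\<lambda>n. cnorm A (cdiff A (cmult A (unit_sum A e n) x) x)) \<longlonglongrightarrow> 0"
    and state: "\<omega> \<in> state_space A"
    and state_unit: "\<omega> (e 0 0) = 1"
begin

abbreviation p :: "nat \<Rightarrow> 'a" where "p \<equiv> unit_sum A e"

lemma p_closed: "p n \<in> carrier A"
  by (induction n) (simp_all add: zero_closed add_closed unit_closed)

lemma p_star: "cstar A (p n) = p n"
  by (induction n) (simp_all add: star_zero star_add p_closed unit_closed unit_star)

lemma p_mult_unit: "n \<le> k \<Longrightarrow> cmult A (p n) (e k k) = czero A"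
  by (induction n)
    (simp_all add: mult_zero_left mult_add_left p_closed unit_closed unit_mult add_zero zero_closed)

lemma unit_mult_p: "n \<le> k \<Longrightarrow> cmult A (e k k) (p n) = czero A"
  by (induction n)
    (simp_all add: mult_zero_right mult_add_right p_closed unit_closed unit_mult add_zero zero_closed)

lemma p_idem: "cmult A (p n) (p n) = p n"
proof (induction n)
  case 0
  show ?case by (simp add: mult_zero_left zero_closed)
next
  case (Suc n)
  have "cadd A (czero A) (e n n) = e n n"
    using add_commute[OF zero_closed unit_closed] add_zero[OF unit_closed] by simp
  with Suc show ?case
    by (simp add: mult_add_left mult_add_right p_closed unit_closed add_closed p_mult_unit
        unit_mult_p unit_mult add_zero)
qed

lemma p_norm: "cnorm A (p n) \<le> 1"
  by (rule projection_norm_le_one) (simp_all add: p_closed p_star p_idem)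

lemma unit_in_unit_ball: "e i j \<in> unit_ball A"
proof -
  have "cnorm A (e j j) \<le> 1"
    by (rule projection_norm_le_one) (simp_all add: unit_closed unit_star unit_mult)
  moreover have "(cnorm A (e i j))\<^sup>2 = cnorm A (e j j)"
    using norm_star_mult_self[OF unit_closed[of i j]] by (simp add: unit_star unit_mult)
  ultimately have "(cnorm A (e i j))\<^sup>2 \<le> 1\<^sup>2" by simp
  then have "cnorm A (e i j) \<le> 1" by (rule power2_le_imp_le) simp
  then show ?thesis by (simp add: unit_ball_def unit_closed)
qed

lemma state_diag_unit_nonneg:
  assumes "\<phi> \<in> state_space A"
  shows "Re (\<phi> (e n n)) \<ge> 0"
  using state_nonneg[OF assms unit_closed[of n n]]
  by (simp add: unit_star unit_mult complex_nonneg_Reals_iff)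

lemma state_p_mono:
  assumes "\<phi> \<in> state_space A" "m \<le> n"
  shows "Re (\<phi> (p m)) \<le> Re (\<phi> (p n))"
  using assms(2)
  by (induction rule: dec_induct)
    (use state_diag_unit_nonneg[OF assms(1)] in
      \<open>force simp: state_add[OF assms(1)] p_closed unit_closed intro: order_trans\<close>)+

lemma state_p_le_one:
  assumes "\<phi> \<in> state_space A"
  shows "Re (\<phi> (p n)) \<le> 1"
  using state_norm_le[OF assms p_closed, of n] p_norm[of n] complex_Re_le_cmod[of "\<phi> (p n)"] by linarith

text \<open>
  A state has norm \<open>1\<close>, so it is close to \<open>1\<close> in modulus at some \<open>x\<close> of the unit ball, hence also at
  \<open>p n x\<close> for large \<open>n\<close>. As \<open>p n\<close> is a projection, Cauchy-Schwarz bounds \<open>\<bar>\<phi> (p n x)\<bar>\<^sup>2\<close> by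
  \<open>\<phi> (p n) \<phi> (x* x) \<le> \<phi> (p n)\<close>.
\<close>

lemma state_p_close_to_one:
  assumes \<phi>: "\<phi> \<in> state_space A" and r: "r > 0"
  shows "\<exists>n. Re (\<phi> (p n)) > 1 - r"
proof -
  \<comment> \<open>Small enough that \<open>0 \<le> 1 - 2 d\<close> and \<open>(1 - 2 d)\<^sup>2 \<ge> 1 - r\<close>.\<close>
  define d where "d = min (r / 4) (1 / 2)"
  have d: "d > 0" "d \<le> r / 4" "d \<le> 1 / 2" using r by (auto simp: d_def)
  obtain x where x: "x \<in> carrier A" "cnorm A x \<le> 1" "cmod (\<phi> x) > 1 - d"
    using state_norm_approx[OF \<phi> d(1)] by blast
  obtain n where n: "cnorm A (cdiff A (cmult A (p n) x) x) < d"
    using order_tendstoD(2)[OF approximate_unit[OF x(1)] d(1)] eventually_happens'[OF sequentially_bot]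
    by blast
  let ?y = "cmult A (p n) x"
  have "cmod (\<phi> ?y - \<phi> x) < d"
    using state_norm_le[OF \<phi> diff_closed[OF mult_closed[OF p_closed x(1)] x(1)], of n] n
    by (simp add: state_diff[OF \<phi>] mult_closed p_closed x(1))
  then have "cmod (\<phi> ?y) > 1 - 2 * d"
    using x(3) norm_triangle_ineq2[of "\<phi> x" "\<phi> ?y"] by (simp add: norm_minus_commute)
  then have "(1 - 2 * d)\<^sup>2 < (cmod (\<phi> ?y))\<^sup>2"
    using d by (intro power_strict_mono) auto
  also have "\<dots> \<le> Re (\<phi> (p n)) * Re (\<phi> (cmult A (cstar A x) x))"
    using state_Cauchy_Schwarz[OF \<phi> p_closed x(1), of n] by (simp add: p_star p_idem)
  also have "\<dots> \<le> Re (\<phi> (p n)) * 1"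
  proof (rule mult_left_mono)
    have "cnorm A (cmult A (cstar A x) x) \<le> 1"
      using norm_star_mult_self[OF x(1)] x(2) norm_nonneg[OF x(1)] by (simp add: power_le_one)
    then show "Re (\<phi> (cmult A (cstar A x) x)) \<le> 1"
      using state_norm_le[OF \<phi> mult_closed[OF star_closed[OF x(1)] x(1)]]
        complex_Re_le_cmod[of "\<phi> (cmult A (cstar A x) x)"] by linarith
    show "Re (\<phi> (p n)) \<ge> 0" using state_p_mono[OF \<phi>, of 0 n] by (simp add: state_zero[OF \<phi>])
  qed
  finally have "(1 - 2 * d)\<^sup>2 < Re (\<phi> (p n))" by simp
  moreover have "(1 - 2 * d)\<^sup>2 \<ge> 1 - r" 
  proof -
    have "(1 - 2 * d)\<^sup>2 = 1 - 4 * d + 4 * d\<^sup>2" by (simp add: power2_eq_square algebra_simps)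
    with d zero_le_power2[of d] show ?thesis by linarith
  qed
  ultimately show ?thesis by (intro exI[of _ n]) linarith
qed

text \<open>
  Dini's argument: the sets of states with \<open>Re (\<phi> (p n)) > 1 - r\<close> are weak* open, increase with \<open>n\<close>, and
  cover \<open>K\<close>, so one of them contains \<open>K\<close>.
\<close>

lemma compact_states_uniformly_tight:
  assumes K: "compactin (weak_star_topology A) K" and r: "r > 0"
  obtains n where "\<And>\<phi>. \<phi> \<in> K \<Longrightarrow> Re (\<phi> (p n)) > 1 - r"
proof -
  define U where "U n = {\<phi> \<in> topspace (weak_star_topology A). \<phi> (p n) \<in> {z. Re z > 1 - r}}" for n
  have "openin (weak_star_topology A) (U n)" for n
    unfolding U_def
    by (rule openin_continuous_map_preimage[OF continuous_map_weak_star_eval[OF p_closed]])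
      (simp add: open_halfspace_Re_gt)
  moreover have "K \<subseteq> (\<Union>n. U n)"
    using compactin_subset_topspace[OF K] state_p_close_to_one[OF state_mem_of_compactin[OF K] r]
    by (force simp: U_def)
  ultimately obtain F where F: "finite F" "F \<subseteq> range U" "K \<subseteq> \<Union>F"
    using K unfolding compactin_def by (metis (no_types, lifting) imageE)
  then obtain I where I: "finite I" "F = U ` I" by (meson finite_subset_image)
  \<comment> \<open>Inserting \<open>0\<close> keeps the maximum meaningful when \<open>K\<close>, and with it \<open>I\<close>, is empty.\<close>
  have "Re (\<phi> (p (Max (insert 0 I)))) > 1 - r" if "\<phi> \<in> K" for \<phi>
  proof -
    obtain i where i: "i \<in> I" "\<phi> \<in> U i" using \<open>\<phi> \<in> K\<close> F(3) I(2) by blast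
    have "Re (\<phi> (p i)) \<le> Re (\<phi> (p (Max (insert 0 I))))"
      using i(1) I(1) by (intro state_p_mono state_mem_of_compactin[OF K that]) simp
    with i(2) show ?thesis by (simp add: U_def)
  qed
  with that show thesis by blast
qed

lemma diag_unit_uniformly_small:
  assumes K: "compactin (weak_star_topology A) K" and r: "r > 0"
  shows "\<forall>\<^sub>F n in sequentially. \<forall>\<phi>\<in>K. Re (\<phi> (e n n)) \<le> r"
proof -
  obtain m where m: "\<And>\<phi>. \<phi> \<in> K \<Longrightarrow> Re (\<phi> (p m)) > 1 - r"
    using compact_states_uniformly_tight[OF K r] by blast
  have "Re (\<phi> (e n n)) \<le> r" if "n \<ge> m" "\<phi> \<in> K" for n \<phi>
  proof -
    note \<phi> = state_mem_of_compactin[OF K that(2)]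
    have "Re (\<phi> (p n)) + Re (\<phi> (e n n)) \<le> 1"
      using state_p_le_one[OF \<phi>, of "Suc n"] by (simp add: state_add[OF \<phi>] p_closed unit_closed)
    with m[OF that(2)] state_p_mono[OF \<phi> that(1)] show ?thesis by linarith
  qed
  then show ?thesis by (auto simp: eventually_sequentially)
qed

text \<open>
  Cauchy-Schwarz for the factorisations \<open>e 0 n = (e 0 0)* (e 0 n)\<close> and \<open>e n 0 = (e 0 n)* (e 0 0)\<close>, with
  \<open>\<phi> (e 0 0) \<le> 1\<close>.
\<close>

lemma state_unit_bound:
  assumes \<phi>: "\<phi> \<in> state_space A"
  shows "(cmod (\<phi> (e 0 n)))\<^sup>2 \<le> Re (\<phi> (e n n))" "(cmod (\<phi> (e n 0)))\<^sup>2 \<le> Re (\<phi> (e n n))"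
proof -
  have "cnorm A (e 0 0) \<le> 1" using unit_in_unit_ball by (simp add: unit_ball_def)
  then have le: "Re (\<phi> (e 0 0)) \<le> 1"
    using state_norm_le[OF \<phi> unit_closed, of 0 0] complex_Re_le_cmod[of "\<phi> (e 0 0)"] by linarith
  have "Re (\<phi> (e 0 0)) * Re (\<phi> (e n n)) \<le> 1 * Re (\<phi> (e n n))"
    by (intro mult_right_mono le state_diag_unit_nonneg[OF \<phi>])
  then show "(cmod (\<phi> (e 0 n)))\<^sup>2 \<le> Re (\<phi> (e n n))" "(cmod (\<phi> (e n 0)))\<^sup>2 \<le> Re (\<phi> (e n n))"
    using state_Cauchy_Schwarz[OF \<phi> unit_closed unit_closed, of 0 0 0 n]
      state_Cauchy_Schwarz[OF \<phi> unit_closed unit_closed, of 0 n 0 0]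
    by (simp_all add: unit_star unit_mult mult.commute)
qed

lemma limitin_wu_units:
  "limitin (wu_topology A) (\<lambda>n. e 0 n) (czero A) sequentially"
  "limitin (wu_topology A) (\<lambda>n. e n 0) (czero A) sequentially"
proof -
  have "\<forall>\<^sub>F n in sequentially. \<forall>\<phi>\<in>K. cmod (\<phi> (e 0 n)) \<le> r \<and> cmod (\<phi> (e n 0)) \<le> r"
    if K: "compactin (weak_star_topology A) K" and r: "r > 0" for K r
  proof -
    have "r\<^sup>2 > 0" using r by simp
    from diag_unit_uniformly_small[OF K this] show ?thesis
    proof (rule eventually_mono, intro ballI)
      fix n \<phi> assume *: "\<forall>\<phi>\<in>K. Re (\<phi> (e n n)) \<le> r\<^sup>2" and \<phi>: "\<phi> \<in> K"
      have "(cmod (\<phi> (e 0 n)))\<^sup>2 \<le> r\<^sup>2" "(cmod (\<phi> (e n 0)))\<^sup>2 \<le> r\<^sup>2"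
        using state_unit_bound[OF state_mem_of_compactin[OF K \<phi>], of n] * \<phi> by force+
      then show "cmod (\<phi> (e 0 n)) \<le> r \<and> cmod (\<phi> (e n 0)) \<le> r"
        using r by (auto intro: power2_le_imp_le)
    qed
  qed
  then show "limitin (wu_topology A) (\<lambda>n. e 0 n) (czero A) sequentially"
    "limitin (wu_topology A) (\<lambda>n. e n 0) (czero A) sequentially"
    by (intro limitin_wu_zero unit_closed; force elim!: eventually_mono)+
qed

text \<open>
  Joint continuity would force \<open>e 0 n \<cdot> e n 0 = e 0 0\<close> to converge to \<open>0 \<cdot> 0 = 0\<close>, yet the one-element
  compact set \<open>{\<omega>}\<close> gives a neighbourhood of \<open>0\<close> that avoids \<open>e 0 0\<close>.
\<close>

theorem mult_not_jointly_continuous: "\<not> mult_jointly_continuous_on A (unit_ball A)"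
proof
  let ?B = "subtopology (wu_topology A) (unit_ball A)"
  assume "mult_jointly_continuous_on A (unit_ball A)"
  then have cont: "continuous_map (prod_topology ?B ?B) (wu_topology A) (\<lambda>(a, b). cmult A a b)"
    by (simp add: mult_jointly_continuous_on_def)
  have "limitin (prod_topology ?B ?B) (\<lambda>n. (e 0 n, e n 0)) (czero A, czero A) sequentially"
    using limitin_wu_units
    by (simp add: limitin_pairwise limitin_subtopology zero_in_unit_ball unit_in_unit_ball comp_def)
  from continuous_map_limit[OF cont this]
  have lim: "limitin (wu_topology A) (\<lambda>n. e 0 0) (czero A) sequentially"
    by (simp add: comp_def unit_mult mult_zero_left zero_closed)
  have K: "compactin (weak_star_topology A) {\<omega>}"
    using state by (intro finite_imp_compactin) (auto simp: weak_star_topology_def state_space_def PiE_def)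
  let ?U = "{b \<in> carrier A. state_seminorm {\<omega>} (cdiff A b (czero A)) < 1}"
  have "openin (wu_topology A) ?U" by (rule openin_wu_seminorm_ball[OF K zero_closed]) simp
  moreover have "czero A \<in> ?U"
    by (simp add: state_seminorm_def zero_closed diff_self state_zero[OF state])
  ultimately have "e 0 0 \<in> ?U" using lim unfolding limitin_def eventually_const_iff by auto
  then show False
    by (simp add: state_seminorm_def state_diff[OF state] unit_closed zero_closed
        state_unit state_zero[OF state])
qed

end

section \<open>Orthonormal bases\<close>

locale orthonormal_sequence =
  fixes e :: "nat \<Rightarrow> 'h::chilbert_space"
  assumes orthonormal: "cinner (e i) (e j) = (if i = j then 1 else 0)"
begin

definition proj :: "nat \<Rightarrow> 'h \<Rightarrow> 'h" where
  "proj n x = (\<Sum>i<n. scaleC (cinner x (e i)) (e i))"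

lemma cinner_sum_basis:
  "finite I \<Longrightarrow> cinner (\<Sum>i\<in>I. scaleC (c i) (e i)) (e j) = (if j \<in> I then c j else 0)"
  by (simp add: cinner_sum_left cinner_scaleC_left orthonormal if_distrib cong: if_cong)

lemma norm_sum_basis:
  assumes "finite I"
  shows "(norm (\<Sum>i\<in>I. scaleC (c i) (e i)))\<^sup>2 = (\<Sum>i\<in>I. (cmod (c i))\<^sup>2)"
proof -
  let ?s = "\<Sum>i\<in>I. scaleC (c i) (e i)"
  have "cinner ?s ?s = (\<Sum>i\<in>I. cnj (c i) * cinner ?s (e i))"
    by (simp only: cinner_sum_right cinner_scaleC_right)
  also have "\<dots> = (\<Sum>i\<in>I. of_real ((cmod (c i))\<^sup>2))"
    by (intro sum.cong) (simp_all only: cinner_sum_basis[OF assms] if_True complex_norm_square mult.commute)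
  finally have "complex_of_real ((norm ?s)\<^sup>2) = of_real (\<Sum>i\<in>I. (cmod (c i))\<^sup>2)"
    by (simp only: cinner_self of_real_sum)
  then show ?thesis by (simp only: of_real_eq_iff)
qed

lemma norm_proj: "(norm (proj n x))\<^sup>2 = (\<Sum>i<n. (cmod (cinner x (e i)))\<^sup>2)"
  unfolding proj_def by (rule norm_sum_basis) simp

lemma norm_diff_proj: "(norm (x - proj n x))\<^sup>2 = (norm x)\<^sup>2 - (\<Sum>i<n. (cmod (cinner x (e i)))\<^sup>2)"
proof -
  have "cinner (x - proj n x) (e i) = 0" if "i < n" for i
    using that by (simp add: cinner_diff_left proj_def cinner_sum_basis)
  then have "cinner (x - proj n x) (proj n x) = 0"
    by (simp add: proj_def[of n x] cinner_sum_right cinner_scaleC_right)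
  then have "(norm x)\<^sup>2 = (norm (x - proj n x))\<^sup>2 + (norm (proj n x))\<^sup>2"
    using norm_add_square[of "x - proj n x" "proj n x"] by simp
  then show ?thesis by (simp add: norm_proj)
qed

lemma norm_proj_le: "norm (proj n x) \<le> norm x"
proof -
  have "(norm (proj n x))\<^sup>2 \<le> (norm x)\<^sup>2"
    using norm_diff_proj[of x n] norm_proj[of n x] zero_le_power2[of "norm (x - proj n x)"] by linarith
  then show ?thesis by (rule power2_le_imp_le) simp
qed

lemma proj_diff: "proj n (x - y) = proj n x - proj n y"
  by (simp add: proj_def cinner_diff_left scaleC_diff_left sum_subtractf)

text \<open>
  By Bessel's inequality the squared coefficients are summable, and their tails control the distances
  between the partial sums.
\<close>

lemma convergent_proj: "\<exists>y. (\<lambda>n. proj n x) \<longlonglongrightarrow> y"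
proof -
  have "(\<Sum>i\<le>n. (cmod (cinner x (e i)))\<^sup>2) \<le> (norm x)\<^sup>2" for n
    using norm_proj[of "Suc n" x] power_mono[OF norm_proj_le norm_ge_zero, of "Suc n" x 2]
    by (simp only: lessThan_Suc_atMost)
  then have "summable (\<lambda>i. (cmod (cinner x (e i)))\<^sup>2)"
    by (rule bounded_imp_summable[rotated]) simp
  then have tail: "\<And>r. r > 0 \<Longrightarrow> \<exists>N. \<forall>m\<ge>N. \<forall>n. norm (\<Sum>i=m..<n. (cmod (cinner x (e i)))\<^sup>2) < r"
    by (simp add: summable_Cauchy)
  have "Cauchy (\<lambda>n. proj n x)"
  proof (rule CauchyI')
    fix r :: real assume "r > 0"
    then obtain N where N: "\<And>m n. m \<ge> N \<Longrightarrow> norm (\<Sum>i=m..<n. (cmod (cinner x (e i)))\<^sup>2) < r\<^sup>2"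
      using tail[of "r\<^sup>2"] by auto
    have "dist (proj m x) (proj n x) < r" if "m \<ge> N" "n > m" for m n
    proof -
      have "proj n x - proj m x = (\<Sum>i=m..<n. scaleC (cinner x (e i)) (e i))"
        using that(2) unfolding proj_def lessThan_atLeast0 by (intro sum_diff_nat_ivl) auto
      then have "(norm (proj n x - proj m x))\<^sup>2 < r\<^sup>2"
        using N[OF that(1), of n] by (simp add: norm_sum_basis)
      then show ?thesis using \<open>r > 0\<close> by (simp add: dist_norm norm_minus_commute power2_less_imp_less)
    qed
    then show "\<exists>M. \<forall>m\<ge>M. \<forall>n>m. dist (proj m x) (proj n x) < r" by blast
  qed
  then show ?thesis using Cauchy_convergent convergent_def by blast
qed

text \<open>
  The partial sums converge to a vector with the same coefficients as \<open>x\<close>; by totality it is \<open>x\<close>.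
\<close>

lemma proj_tendstoI:
  assumes total: "\<And>z. (\<And>i. cinner z (e i) = 0) \<Longrightarrow> z = 0"
  shows "(\<lambda>n. proj n x) \<longlonglongrightarrow> x"
proof -
  obtain y where y: "(\<lambda>n. proj n x) \<longlonglongrightarrow> y" using convergent_proj by blast
  have "cinner y (e i) = cinner x (e i)" for i
  proof (rule LIMSEQ_unique[OF tendsto_cinner_left[OF y]])
    have "cinner (proj n x) (e i) = cinner x (e i)" if "n \<ge> Suc i" for n
      using that by (simp add: proj_def cinner_sum_basis)
    then show "(\<lambda>n. cinner (proj n x) (e i)) \<longlonglongrightarrow> cinner x (e i)"
      by (intro tendsto_eventually eventually_sequentiallyI)
  qed
  then have "x - y = 0" by (intro total) (simp add: cinner_diff_left)
  with y show ?thesis by simp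
qed

end

locale orthonormal_basis = orthonormal_sequence e for e :: "nat \<Rightarrow> 'h::chilbert_space" +
  assumes expansion: "(\<lambda>n. proj n x) \<longlonglongrightarrow> x"

definition orthonormal_set :: "'h::complex_inner set \<Rightarrow> bool" where
  "orthonormal_set B \<longleftrightarrow> (\<forall>u\<in>B. \<forall>v\<in>B. cinner u v = (if u = v then 1 else 0))"

text \<open>
  Zorn's lemma: a nonzero vector orthogonal to a maximal orthonormal set could be normalised and added
  to it.
\<close>

lemma maximal_orthonormal_set_exists:
  "\<exists>B::'h::complex_inner set. orthonormal_set B \<and> (\<forall>z. (\<forall>u\<in>B. cinner z u = 0) \<longrightarrow> z = 0)"
proof -
  have "\<exists>B\<in>{B::'h set. orthonormal_set B}. \<forall>C\<in>{B. orthonormal_set B}. B \<subseteq> C \<longrightarrow> C = B"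
  proof (rule subset_Zorn')
    fix \<C> :: "'h set set" assume \<C>: "subset.chain {B. orthonormal_set B} \<C>"
    have "cinner u v = (if u = v then 1 else 0)" if uv: "u \<in> \<Union>\<C>" "v \<in> \<Union>\<C>" for u v
    proof -
      obtain U V where UV: "U \<in> \<C>" "u \<in> U" "V \<in> \<C>" "v \<in> V" using uv by blast
      then have "U \<subseteq> V \<or> V \<subseteq> U" using \<C> by (simp add: subset_chain_def)
      with UV obtain B where "B \<in> \<C>" "u \<in> B" "v \<in> B" by blast
      moreover from \<C> have "\<C> \<subseteq> {B. orthonormal_set B}" by (simp add: subset_chain_def)
      ultimately show ?thesis unfolding orthonormal_set_def by blast
    qed
    then show "\<Union>\<C> \<in> {B. orthonormal_set B}" by (simp add: orthonormal_set_def)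
  qed
  then obtain B :: "'h set" where B: "orthonormal_set B" "\<And>C. orthonormal_set C \<Longrightarrow> B \<subseteq> C \<Longrightarrow> C = B"
    by blast
  have "z = 0" if z: "\<forall>u\<in>B. cinner z u = 0" for z
  proof (rule ccontr)
    assume "z \<noteq> 0"
    define w where "w = scaleC (of_real (1 / norm z)) z"
    have "norm w = 1" using \<open>z \<noteq> 0\<close> by (simp add: w_def norm_scaleC norm_divide)
    then have w: "cinner w w = 1" by (simp add: cinner_self)
    have wu: "cinner w u = 0" "cinner u w = 0" if "u \<in> B" for u
      using that z cinner_commute[of u w] by (simp_all add: w_def cinner_scaleC_left)
    then have "orthonormal_set (insert w B)"
      using B(1) w unfolding orthonormal_set_def by fastforce
    then have "w \<in> B" using B(2)[of "insert w B"] by blast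
    with wu w show False by force
  qed
  with B(1) show ?thesis by blast
qed

text \<open>
  Distinct elements are at distance \<open>sqrt 2\<close>, so different ones are close to different points of a countable
  dense set.
\<close>

lemma orthonormal_set_countable:
  fixes B :: "'h::complex_inner set"
  assumes sep: "separable_space (euclidean :: 'h topology)" and B: "orthonormal_set B"
  shows "countable B"
proof -
  obtain D :: "'h set" where D: "countable D" "closure D = UNIV"
    using sep by (auto simp: separable_space_def)
  have "u \<in> closure D" for u using D(2) by simp
  then have "\<exists>d\<in>D. dist d u < 1 / 2" for u
    unfolding closure_approachable by (meson half_gt_zero zero_less_one)
  then obtain d where d: "\<And>u. d u \<in> D" "\<And>u. dist (d u) u < 1 / 2" by metis
  have "inj_on d B"
  proof (rule inj_onI, rule ccontr)
    fix u v assume uv: "u \<in> B" "v \<in> B" "d u = d v" "u \<noteq> v"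
    then have "cinner (u - v) (u - v) = 2"
      using B unfolding orthonormal_set_def by (simp add: cinner_diff_left cinner_diff_right)
    then have "complex_of_real ((norm (u - v))\<^sup>2) = of_real 2" by (simp only: cinner_self) simp
    then have "(norm (u - v))\<^sup>2 = 2" by (simp only: of_real_eq_iff)
    moreover have "norm (u - v) < 1"
      using d(2)[of u] d(2)[of v] uv(3) dist_triangle3[of u v "d u"] by (simp add: dist_norm)
    then have "(norm (u - v))\<^sup>2 \<le> 1" by (simp add: power_le_one)
    ultimately show False by simp
  qed
  moreover have "countable (d ` B)" using d(1) D(1) by (meson countable_subset image_subsetI)
  ultimately show ?thesis using countable_image_inj_on by blast
qed

text \<open>
  A maximal orthonormal set is countable by separability. If it were finite, the expansion with respect
  to it would show that it spans the whole space. Its enumeration is therefore a basis indexed by the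
  natural numbers.
\<close>

theorem orthonormal_basis_exists:
  assumes sep: "separable_space (euclidean :: 'h::chilbert_space topology)"
    and inf: "infinite_dimensional TYPE('h)"
  shows "\<exists>e :: nat \<Rightarrow> 'h. orthonormal_basis e"
proof -
  obtain B :: "'h set" where B: "orthonormal_set B" "\<And>z. (\<And>u. u \<in> B \<Longrightarrow> cinner z u = 0) \<Longrightarrow> z = 0"
    using maximal_orthonormal_set_exists by blast
  interpret vector_space "scaleC :: complex \<Rightarrow> 'h \<Rightarrow> 'h" by (rule vector_space_scaleC)
  have "infinite B"
  proof
    assume fin: "finite B"
    have "x \<in> span B" for x
    proof -
      let ?s = "\<Sum>u\<in>B. scaleC (cinner x u) u"
      have "cinner ?s v = cinner x v" if "v \<in> B" for v
      proof -
        have "cinner ?s v = (\<Sum>u\<in>B. cinner x u * (if u = v then 1 else 0))"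
          using B(1) that by (simp add: cinner_sum_left cinner_scaleC_left orthonormal_set_def)
        then show ?thesis using fin that by (simp add: if_distrib cong: if_cong)
      qed
      then have "x - ?s = 0" by (intro B(2)) (simp add: cinner_diff_left)
      moreover have "?s \<in> span B" by (intro span_sum span_scale span_base)
      ultimately show ?thesis by simp
    qed
    then have "span B = UNIV" by blast
    with fin inf show False unfolding infinite_dimensional_def by blast
  qed
  then have bij: "bij_betw (from_nat_into B) UNIV B"
    using orthonormal_set_countable[OF sep B(1)] by (intro bij_betw_from_nat_into)
  let ?e = "from_nat_into B"
  have e: "?e i \<in> B" "?e i = ?e j \<longleftrightarrow> i = j" "range ?e = B" for i j
    using bij by (auto simp: bij_betw_def inj_on_def)
  interpret orthonormal_sequence ?e
    by unfold_locales (use B(1) e in \<open>simp add: orthonormal_set_def\<close>)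
  show ?thesis
  proof (rule exI[of _ ?e])
    show "orthonormal_basis ?e"
    proof (unfold_locales, rule proj_tendstoI, rule B(2))
      fix z u assume "\<And>i. cinner z (?e i) = 0" "u \<in> B"
      then show "cinner z u = 0" using e(3) by (metis imageE)
    qed
  qed
qed

section \<open>Matrix units in the compact operators\<close>

definition rank_one :: "'h::complex_inner \<Rightarrow> 'h \<Rightarrow> 'h \<Rightarrow> 'h" where
  "rank_one u v x = scaleC (cinner x v) u"

lemma clinear_rank_one: "clinear (rank_one u v)"
  by (simp add: clinear_iff rank_one_def cinner_add_left cinner_scaleC_left scaleC_add_left scaleC_scaleC)

text \<open>
  The image of the unit ball lies in the image of a disc of scalars, which is compact.
\<close>

lemma rank_one_compact: "rank_one u v \<in> carrier compact_operators" for u v :: "'h::chilbert_space"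
proof -
  let ?C = "(\<lambda>c. scaleC c u) ` cball 0 (norm v)"
  have "compact ?C"
    by (intro compact_continuous_image linear_continuous_on bounded_linear_scaleC_left compact_cball)
  moreover have "rank_one u v ` cball 0 1 \<subseteq> ?C"
  proof
    fix y assume "y \<in> rank_one u v ` cball 0 1"
    then obtain x where x: "norm x \<le> 1" "y = scaleC (cinner x v) u"
      by (auto simp: rank_one_def)
    have "cmod (cinner x v) \<le> 1 * norm v"
      using cinner_Cauchy_Schwarz[of x v] mult_right_mono[OF x(1) norm_ge_zero[of v]] by linarith
    with x(2) show "y \<in> ?C" by auto
  qed
  ultimately have "closure (rank_one u v ` cball 0 1) \<subseteq> ?C"
    by (intro closure_minimal compact_imp_closed)
  then have "compact (closure (rank_one u v ` cball 0 1))"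
    using compact_Int_closed[OF \<open>compact ?C\<close> closed_closure[of "rank_one u v ` cball 0 1"]]
    by (simp add: Int_absorb1)
  then show ?thesis by (simp add: compact_operators_def clinear_rank_one)
qed

lemma adjoint_op_rank_one: "adjoint_op (rank_one u v) = rank_one v u" for u v :: "'h::chilbert_space"
  by (rule adjoint_op_eqI)
    (simp add: rank_one_def cinner_scaleC_left cinner_scaleC_right mult.commute cinner_commute[of u])

lemma onorm_rank_one_le: "onorm (rank_one u v) \<le> norm u * norm v"
proof (rule onorm_bound)
  show "norm (rank_one u v x) \<le> norm u * norm v * norm x" for x
    using mult_right_mono[OF cinner_Cauchy_Schwarz[of x v] norm_ge_zero[of u]]
    by (simp add: rank_one_def norm_scaleC mult_ac)
qed simp

text \<open>
  The functional has norm \<open>1\<close> because it takes the value \<open>1\<close> at the projection onto the line through \<open>v\<close>.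
\<close>

lemma vector_state:
  fixes v :: "'h::chilbert_space"
  assumes v: "norm v = 1"
  shows "restrict (\<lambda>T. cinner (T v) v) (carrier compact_operators) \<in> state_space compact_operators"
proof -
  let ?A = "compact_operators :: ('h \<Rightarrow> 'h) cstar_record"
  let ?\<omega> = "restrict (\<lambda>T. cinner (T v) v) (carrier ?A)"
  interpret cstar_algebra ?A by (rule cstar_algebra_compact_operators)
  have bound: "cmod (?\<omega> T) \<le> onorm T" if "T \<in> carrier ?A" for T
    using cinner_Cauchy_Schwarz[of "T v" v] onorm[OF compact_operator_bounded_linear[OF that], of v] v that
    by simp
  have bf: "bounded_functional ?A ?\<omega>"
    unfolding bounded_functional_def
  proof (intro conjI ballI allI exI[of _ 1])
    show "?\<omega> (cadd ?A x y) = ?\<omega> x + ?\<omega> y" if "x \<in> carrier ?A" "y \<in> carrier ?A" for x y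
      using that add_closed[OF that] by (simp add: compact_operators_simps cinner_add_left)
    show "?\<omega> (cscale ?A c x) = c * ?\<omega> x" if "x \<in> carrier ?A" for c x
      using that scale_closed[OF that, of c] by (simp add: compact_operators_simps cinner_scaleC_left)
    show "cmod (?\<omega> x) \<le> 1 * cnorm ?A x" if "x \<in> carrier ?A" for x
      using bound[OF that] by (simp add: compact_operators_simps)
  qed
  have pos: "?\<omega> (cmult ?A (cstar ?A x) x) \<in> \<real>\<^sub>\<ge>\<^sub>0" if "x \<in> carrier ?A" for x
  proof -
    have "?\<omega> (cmult ?A (cstar ?A x) x) = cinner (x v) (x v)"
      using mult_closed[OF star_closed[OF that] that]
      by (simp add: compact_operators_simps
          cinner_adjoint_op'[OF compact_operator_clinear[OF that] compact_operator_bounded_linear[OF that]])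
    then show ?thesis using cinner_self_nonneg by metis
  qed
  have "functional_norm ?A ?\<omega> = 1"
    unfolding functional_norm_def
  proof (rule cSup_eq_maximum)
    have "rank_one v v \<in> unit_ball ?A"
      using onorm_rank_one_le[of v v] v by (simp add: unit_ball_def rank_one_compact compact_operators_simps)
    moreover have "cmod (?\<omega> (rank_one v v)) = 1"
      using v by (simp add: rank_one_compact rank_one_def cinner_self)
    ultimately show "1 \<in> (\<lambda>x. cmod (?\<omega> x)) ` unit_ball ?A" by (metis image_eqI)
    show "y \<le> 1" if "y \<in> (\<lambda>x. cmod (?\<omega> x)) ` unit_ball ?A" for y
      using that bound by (fastforce simp: unit_ball_def compact_operators_simps)
  qed
  with bf pos show ?thesis by (simp add: state_space_def)
qed

context orthonormal_basis
begin

definition unit :: "nat \<Rightarrow> nat \<Rightarrow> 'h \<Rightarrow> 'h" where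
  "unit i j = rank_one (e i) (e j)"

lemma unit_sum_unit: "unit_sum compact_operators unit n = proj n"
  by (induction n) (simp_all add: proj_def compact_operators_simps unit_def rank_one_def fun_eq_iff)

text \<open>
  The contractions \<open>proj n\<close> converge pointwise to the identity, hence uniformly on the totally bounded
  image of the unit ball under \<open>T\<close>.
\<close>

lemma proj_comp_compact_tendsto:
  assumes T: "T \<in> carrier compact_operators"
  shows "(\<lambda>n. onorm (\<lambda>x. proj n (T x) - T x)) \<longlonglongrightarrow> 0"
proof (rule LIMSEQ_I)
  fix r :: real assume r: "r > 0"
  then have "r / 4 > 0" by simp
  then obtain k where k: "finite k" "\<And>x. norm x \<le> 1 \<Longrightarrow> \<exists>y\<in>k. norm (T x - y) < r / 4"
    using compact_operator_net[OF T] by blast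
  have "\<forall>\<^sub>F n in sequentially. \<forall>y\<in>k. dist (proj n y) y < r / 4"
    using k(1) by (intro eventually_ball_finite ballI tendstoD expansion \<open>r / 4 > 0\<close>)
  then obtain N where N: "\<And>n y. n \<ge> N \<Longrightarrow> y \<in> k \<Longrightarrow> norm (proj n y - y) < r / 4"
    by (auto simp: eventually_sequentially dist_norm)
  have "norm (onorm (\<lambda>x. proj n (T x) - T x) - 0) < r" if n: "n \<ge> N" for n
  proof -
    have lin: "clinear (\<lambda>x. proj n (T x) - T x)"
      using compact_operator_clinear[OF T]
      by (simp add: clinear_iff proj_def cinner_add_left cinner_scaleC_left scaleC_add_left
          sum.distrib scaleC_scaleC scaleC_diff_right scaleC_sum_right)
    have le: "norm (proj n (T x) - T x) \<le> 3 * (r / 4)" if x: "norm x \<le> 1" for x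
    proof -
      obtain y where y: "y \<in> k" "norm (T x - y) < r / 4" using k(2)[OF x] by blast
      have "proj n (T x) - T x = proj n (T x - y) + (proj n y - y) - (T x - y)"
        by (simp add: proj_diff)
      then have "norm (proj n (T x) - T x)
          \<le> norm (proj n (T x - y)) + norm (proj n y - y) + norm (T x - y)"
        using norm_triangle_ineq[of "proj n (T x - y)" "proj n y - y"]
          norm_triangle_ineq4[of "proj n (T x - y) + (proj n y - y)" "T x - y"] by simp
      with norm_proj_le[of n "T x - y"] N[OF n y(1)] y(2) show ?thesis by linarith
    qed
    have "onorm (\<lambda>x. proj n (T x) - T x) \<le> 3 * (r / 4)"
      by (rule clinear_bounded_linear(3)[OF lin le])
    moreover have "onorm (\<lambda>x. proj n (T x) - T x) \<ge> 0"
      by (rule onorm_pos_le[OF clinear_bounded_linear(1)[OF lin le]])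
    ultimately show ?thesis using r by simp
  qed
  then show "\<exists>N. \<forall>n\<ge>N. norm (onorm (\<lambda>x. proj n (T x) - T x) - 0) < r" by blast
qed

theorem compact_operators_matrix_units:
  "cstar_matrix_units compact_operators unit
     (restrict (\<lambda>T. cinner (T (e 0)) (e 0)) (carrier compact_operators))"
proof -
  have norm_e: "norm (e 0) = 1"
    using orthonormal[of 0 0] by (simp add: norm_eq_sqrt_cinner)
  show ?thesis
  proof (intro cstar_matrix_units.intro cstar_algebra_compact_operators cstar_matrix_units_axioms.intro)
    show "unit i j \<in> carrier compact_operators" for i j
      by (simp add: unit_def rank_one_compact)
    show "cmult compact_operators (unit i j) (unit k l) = (if j = k then unit i l else czero compact_operators)"
      for i j k l
      by (auto simp: compact_operators_simps unit_def rank_one_def fun_eq_iff cinner_scaleC_left orthonormal)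
    show "cstar compact_operators (unit i j) = unit j i" for i j
      by (simp add: compact_operators_simps unit_def adjoint_op_rank_one)
    show "(\<lambda>n. cnorm compact_operators (cdiff compact_operators
        (cmult compact_operators (unit_sum compact_operators unit n) T) T)) \<longlonglongrightarrow> 0"
      if "T \<in> carrier compact_operators" for T
      using proj_comp_compact_tendsto[OF that]
      by (simp add: unit_sum_unit cdiff_compact_operators compact_operators_simps)
    show "restrict (\<lambda>T. cinner (T (e 0)) (e 0)) (carrier compact_operators) \<in> state_space compact_operators"
      by (rule vector_state[OF norm_e])
    show "restrict (\<lambda>T. cinner (T (e 0)) (e 0)) (carrier compact_operators) (unit 0 0) = 1"
      by (simp add: unit_def rank_one_compact) (simp add: rank_one_def orthonormal)
  qed
qed

end

section \<open>Separability\<close>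

lemma clinear_sum:
  "clinear T \<Longrightarrow> T (\<Sum>i\<in>I. scaleC (c i) (f i)) = (\<Sum>i\<in>I. scaleC (c i) (T (f i)))"
proof (induction I rule: infinite_finite_induct)
  case (insert i I)
  then show ?case by (simp add: clinear_iff)
qed (use linear_0[OF clinear_imp_linear] in auto)

lemma compact_operator_sum:
  "finite I \<Longrightarrow> (\<And>i. i \<in> I \<Longrightarrow> f i \<in> carrier compact_operators) \<Longrightarrow>
    (\<lambda>x. \<Sum>i\<in>I. f i x) \<in> carrier compact_operators"
  by (induction I rule: finite_induct) (simp_all add: compact_operator_zero compact_operator_add)

lemma scaleC_sum_left: "scaleC (\<Sum>i\<in>I. c i) x = (\<Sum>i\<in>I. scaleC (c i) (x::'a::complex_inner))"
  by (induction I rule: infinite_finite_induct) (simp_all add: scaleC_add_left)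

context orthonormal_basis
begin

lemma cinner_proj: "cinner (proj n x) y = cinner x (proj n y)"
  unfolding proj_def cinner_sum_left cinner_sum_right
  by (intro sum.cong refl) (simp add: cinner_scaleC_left cinner_scaleC_right cinner_commute[of "e _" y])

lemma clinear_proj: "clinear (proj n)"
  by (simp add: clinear_iff proj_def cinner_add_left cinner_scaleC_left scaleC_add_left
      sum.distrib scaleC_scaleC scaleC_sum_right)

lemma bounded_linear_proj: "bounded_linear (proj n)"
  using clinear_bounded_linear(1)[OF clinear_proj, of n 1] norm_proj_le order_trans by blast

text \<open>
  Convergence of \<open>T \<circ> proj n\<close> to \<open>T\<close> follows from that of \<open>proj n \<circ> T*\<close> to \<open>T*\<close>, since the differences are
  adjoint to each other. Together with the convergence of \<open>proj n \<circ> T\<close> this controls the compression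
  \<open>proj n \<circ> T \<circ> proj n\<close>.
\<close>

lemma norm_compression_diff_le:
  assumes T: "T \<in> carrier compact_operators"
  shows "norm (proj n (T (proj n x)) - T x)
    \<le> (onorm (\<lambda>x. proj n (adjoint_op T x) - adjoint_op T x) + onorm (\<lambda>x. proj n (T x) - T x)) * norm x"
proof -
  have bl: "clinear (\<lambda>x. proj n (S x) - S x)" "bounded_linear (\<lambda>x. proj n (S x) - S x)"
    if "S \<in> carrier compact_operators" for S
  proof -
    note S = compact_operator_clinear[OF that] compact_operator_bounded_linear[OF that]
    show "clinear (\<lambda>x. proj n (S x) - S x)"
      using S(1) clinear_proj[of n] by (simp add: clinear_iff scaleC_diff_right)
    show "bounded_linear (\<lambda>x. proj n (S x) - S x)"
      by (intro bounded_linear_sub bounded_linear_compose[OF bounded_linear_proj] S(2))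
  qed
  note T' = compact_operator_clinear[OF T] compact_operator_bounded_linear[OF T]
  let ?R = "\<lambda>x. proj n (adjoint_op T x) - adjoint_op T x"
  have "adjoint_op ?R = (\<lambda>x. T (proj n x) - T x)"
    by (rule adjoint_op_eqI)
      (simp add: cinner_diff_left cinner_diff_right cinner_proj cinner_adjoint_op'[OF T'])
  then have 1: "norm (T (proj n x) - T x) \<le> onorm ?R * norm x"
    using adjoint_op_norm_le[OF bl[OF compact_operator_adjoint[OF T]], of x] by simp
  have 2: "norm (proj n (T x) - T x) \<le> onorm (\<lambda>x. proj n (T x) - T x) * norm x"
    by (rule onorm[OF bl(2)[OF T]])
  have "proj n (T (proj n x)) - T x = proj n (T (proj n x) - T x) + (proj n (T x) - T x)"
    by (simp add: proj_diff)
  then have "norm (proj n (T (proj n x)) - T x)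
      = norm (proj n (T (proj n x) - T x) + (proj n (T x) - T x))" by (simp only:)
  also have "\<dots> \<le> norm (T (proj n x) - T x) + norm (proj n (T x) - T x)"
    using norm_triangle_ineq[of "proj n (T (proj n x) - T x)" "proj n (T x) - T x"]
      norm_proj_le[of n "T (proj n x) - T x"] by linarith
  finally have "norm (proj n (T (proj n x)) - T x)
      \<le> norm (T (proj n x) - T x) + norm (proj n (T x) - T x)" .
  with 1 2 show ?thesis by (simp add: distrib_right)
qed

definition matrix_operator :: "nat \<Rightarrow> (nat \<times> nat \<Rightarrow> complex) \<Rightarrow> 'h \<Rightarrow> 'h" where
  "matrix_operator n q x = (\<Sum>k\<in>{..<n} \<times> {..<n}. scaleC (q k) (unit (fst k) (snd k) x))"

lemma matrix_operator_compact: "matrix_operator n q \<in> carrier compact_operators"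
  unfolding matrix_operator_def unit_def
  by (intro compact_operator_sum compact_operator_scale rank_one_compact) simp

lemma matrix_operator_compression:
  assumes "clinear T"
  shows "proj n (T (proj n x)) = matrix_operator n (\<lambda>(i, j). cinner (T (e j)) (e i)) x"
proof -
  have "cinner (T (proj n x)) (e i) = (\<Sum>j<n. cinner x (e j) * cinner (T (e j)) (e i))" for i
    by (simp add: proj_def clinear_sum[OF assms] cinner_sum_left cinner_scaleC_left)
  then have "proj n (T (proj n x))
      = (\<Sum>i<n. \<Sum>j<n. scaleC (cinner (T (e j)) (e i)) (scaleC (cinner x (e j)) (e i)))"
    unfolding proj_def[of n "T (proj n x)"]
    by (simp add: scaleC_sum_left scaleC_scaleC mult.commute)
  then show ?thesis
    by (simp add: matrix_operator_def unit_def rank_one_def sum.cartesian_product case_prod_unfold)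
qed

lemma norm_matrix_operator_diff_le:
  assumes "\<And>k. k \<in> {..<n} \<times> {..<n} \<Longrightarrow> cmod (q k - q' k) \<le> d"
  shows "norm (matrix_operator n q x - matrix_operator n q' x) \<le> (real n)\<^sup>2 * d * norm x"
proof -
  have "norm (unit i j x) \<le> norm x" for i j
  proof -
    have "norm (e i) = 1" for i
      using orthonormal[of i i] by (simp add: norm_eq_sqrt_cinner)
    then show ?thesis
      using cinner_Cauchy_Schwarz[of x "e j"] by (simp add: unit_def rank_one_def norm_scaleC)
  qed
  then have "norm (scaleC (q k - q' k) (unit (fst k) (snd k) x)) \<le> d * norm x"
    if "k \<in> {..<n} \<times> {..<n}" for k
    unfolding norm_scaleC by (intro mult_mono) (use assms[OF that] order_trans[OF norm_ge_zero] in auto)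
  then have "norm (\<Sum>k\<in>{..<n} \<times> {..<n}. scaleC (q k - q' k) (unit (fst k) (snd k) x))
      \<le> of_nat (card ({..<n} \<times> {..<n})) * (d * norm x)"
    by (intro order_trans[OF norm_sum] sum_bounded_above)
  then show ?thesis
    by (simp add: matrix_operator_def scaleC_diff_left sum_subtractf power2_eq_square mult.assoc)
qed

text \<open>
  A compact operator is approximated by its compressions, which are finite matrices, and a finite matrix
  by one with entries in a countable dense set of scalars. Restricting the entries to a finite index set
  keeps the family of matrices countable.
\<close>

theorem compact_operators_separable: "cstar_separable (compact_operators :: ('h \<Rightarrow> 'h) cstar_record)"
proof -
  obtain Q :: "complex set" where Q: "countable Q" "\<And>X. open X \<Longrightarrow> X \<noteq> {} \<Longrightarrow> \<exists>d\<in>Q. d \<in> X"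
    using countable_dense_exists by metis
  define D where "D = (\<Union>n. matrix_operator n ` ({..<n} \<times> {..<n} \<rightarrow>\<^sub>E Q))"
  have "countable D"
    unfolding D_def by (intro countable_UN countable_image countable_PiE Q(1)) auto
  moreover have "D \<subseteq> carrier compact_operators"
    unfolding D_def using matrix_operator_compact by blast
  moreover have "\<exists>S\<in>D. onorm (\<lambda>x. T x - S x) < r" if T: "T \<in> carrier compact_operators" and r: "r > 0" for T r
  proof -
    let ?a = "\<lambda>n. onorm (\<lambda>x. proj n (adjoint_op T x) - adjoint_op T x)"
    let ?b = "\<lambda>n. onorm (\<lambda>x. proj n (T x) - T x)"
    have "(\<lambda>n. ?a n + ?b n) \<longlonglongrightarrow> 0 + 0"
      by (intro tendsto_add proj_comp_compact_tendsto compact_operator_adjoint T)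
    moreover have "0 + 0 < r / 2" using r by simp
    ultimately have "\<forall>\<^sub>F n in sequentially. ?a n + ?b n < r / 2" by (rule order_tendstoD(2))
    then obtain n where n: "?a n + ?b n < r / 2"
      using eventually_happens'[OF sequentially_bot] by blast
    \<comment> \<open>Each of the \<open>n\<^sup>2\<close> entries may be off by \<open>d\<close>; the summand \<open>1\<close> covers the case \<open>n = 0\<close>.\<close>
    define d where "d = r / (4 * ((real n)\<^sup>2 + 1))"
    have d: "d > 0" "(real n)\<^sup>2 * d \<le> r / 4"
    proof -
      have pos: "(real n)\<^sup>2 + 1 > 0" by (simp add: add_nonneg_pos)
      then show "d > 0" using r by (simp add: d_def)
      have "(real n)\<^sup>2 * d \<le> ((real n)\<^sup>2 + 1) * d" using \<open>d > 0\<close> by (intro mult_right_mono) auto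
      also have "\<dots> = r / 4" using pos by (simp add: d_def field_simps)
      finally show "(real n)\<^sup>2 * d \<le> r / 4" .
    qed
    define c where "c = (\<lambda>(i, j). cinner (T (e j)) (e i))"
    have "\<exists>z\<in>Q. dist (c k) z < d" for k
      using Q(2)[of "ball (c k) d"] d(1) by auto
    then obtain z where z: "\<And>k. z k \<in> Q" "\<And>k. dist (c k) (z k) < d" by metis
    define q where "q = restrict z ({..<n} \<times> {..<n})"
    have "q \<in> {..<n} \<times> {..<n} \<rightarrow>\<^sub>E Q" using z(1) by (simp add: q_def)
    then have "matrix_operator n q \<in> matrix_operator n ` ({..<n} \<times> {..<n} \<rightarrow>\<^sub>E Q)" by (rule imageI)
    then have "matrix_operator n q \<in> D" unfolding D_def by (rule UN_I[OF UNIV_I])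
    moreover have "onorm (\<lambda>x. T x - matrix_operator n q x) \<le> r / 2 + r / 4"
    proof (rule onorm_bound)
      fix x
      have "norm (T x - matrix_operator n c x) \<le> r / 2 * norm x"
      proof -
        have "norm (matrix_operator n c x - T x) \<le> (?a n + ?b n) * norm x"
          using norm_compression_diff_le[OF T, of n x]
            matrix_operator_compression[OF compact_operator_clinear[OF T], of n x] by (simp add: c_def)
        also have "\<dots> \<le> r / 2 * norm x" using n by (intro mult_right_mono) auto
        finally show ?thesis by (simp add: norm_minus_commute)
      qed
      moreover have "norm (matrix_operator n c x - matrix_operator n q x) \<le> r / 4 * norm x"
      proof -
        have "cmod (c k - q k) \<le> d" if "k \<in> {..<n} \<times> {..<n}" for k
          using z(2)[of k] that by (simp add: q_def dist_norm)
        then have "norm (matrix_operator n c x - matrix_operator n q x) \<le> (real n)\<^sup>2 * d * norm x"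
          by (rule norm_matrix_operator_diff_le)
        also have "\<dots> \<le> r / 4 * norm x" by (intro mult_right_mono d(2)) simp
        finally show ?thesis .
      qed
      ultimately show "norm (T x - matrix_operator n q x) \<le> (r / 2 + r / 4) * norm x"
        using norm_triangle_ineq[of "T x - matrix_operator n c x"
            "matrix_operator n c x - matrix_operator n q x"]
        by (simp add: distrib_right)
    qed (use r in simp)
    ultimately show ?thesis using r by (intro bexI[of _ "matrix_operator n q"]) auto
  qed
  ultimately show ?thesis
    unfolding cstar_separable_def cdiff_compact_operators compact_operators_simps by blast
qed

text \<open>
  The entries determine the operator on the basis vectors, then on their finite combinations \<open>proj n x\<close>,
  and by continuity everywhere.
\<close>

lemma matrix_entries_inj: "inj_on (\<lambda>T i j. cinner (T (e j)) (e i)) (carrier compact_operators)"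
proof (rule inj_onI, rule ext)
  fix S T x
  assume S: "S \<in> carrier compact_operators" and T: "T \<in> carrier compact_operators"
    and eq: "(\<lambda>i j. cinner (S (e j)) (e i)) = (\<lambda>i j. cinner (T (e j)) (e i))"
  have lim: "(\<lambda>n. U (proj n x)) \<longlonglongrightarrow> U x" if "U \<in> carrier compact_operators" for U
    by (rule bounded_linear.tendsto[OF compact_operator_bounded_linear[OF that] expansion])
  have "S (e j) = T (e j)" for j
  proof -
    have "proj n (S (e j)) = proj n (T (e j))" for n
      unfolding proj_def by (simp add: fun_cong[OF fun_cong[OF eq]])
    then show ?thesis using LIMSEQ_unique[OF expansion[of "S (e j)"]] expansion[of "T (e j)"] by simp
  qed
  then have "S (proj n x) = T (proj n x)" for n
    unfolding proj_def
    by (simp add: clinear_sum[OF compact_operator_clinear[OF S]] clinear_sum[OF compact_operator_clinear[OF T]])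
  then show "S x = T x" using LIMSEQ_unique[OF lim[OF S]] lim[OF T] by simp
qed

end

section \<open>Transport of C*-algebras along injections\<close>

text \<open>
  Carriers need not exhaust their type, so a C*-algebra can be renamed along any map that is injective
  on its carrier. Off the image the operations have arbitrary values.
\<close>

definition transport :: "('a \<Rightarrow> 'b) \<Rightarrow> 'a cstar_record \<Rightarrow> 'b cstar_record" where
  "transport f A = (let g = inv_into (carrier A) f in \<lparr>
     carrier = f ` carrier A,
     czero = f (czero A),
     cadd = (\<lambda>x y. f (cadd A (g x) (g y))),
     cscale = (\<lambda>c x. f (cscale A c (g x))),
     cmult = (\<lambda>x y. f (cmult A (g x) (g y))),
     cstar = (\<lambda>x. f (cstar A (g x))),
     cnorm = (\<lambda>x. cnorm A (g x))\<rparr>)"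

locale cstar_transport = cstar_algebra A for A :: "'a cstar_record" +
  fixes f :: "'a \<Rightarrow> 'b"
  assumes inj: "inj_on f (carrier A)"
begin

abbreviation "B \<equiv> transport f A"

lemma transport_simps:
  "carrier B = f ` carrier A"
  "czero B = f (czero A)"
  "x \<in> carrier A \<Longrightarrow> y \<in> carrier A \<Longrightarrow> cadd B (f x) (f y) = f (cadd A x y)"
  "x \<in> carrier A \<Longrightarrow> cscale B c (f x) = f (cscale A c x)"
  "x \<in> carrier A \<Longrightarrow> y \<in> carrier A \<Longrightarrow> cmult B (f x) (f y) = f (cmult A x y)"
  "x \<in> carrier A \<Longrightarrow> cstar B (f x) = f (cstar A x)"
  "x \<in> carrier A \<Longrightarrow> cnorm B (f x) = cnorm A x"
  by (simp_all add: transport_def Let_def inj)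

lemma transport_cdiff:
  "x \<in> carrier A \<Longrightarrow> y \<in> carrier A \<Longrightarrow> cdiff B (f x) (f y) = f (cdiff A x y)"
  by (simp add: cdiff_def transport_simps scale_closed)

lemma transport_eq_iff: "x \<in> carrier A \<Longrightarrow> y \<in> carrier A \<Longrightarrow> f x = f y \<longleftrightarrow> x = y"
  using inj by (simp add: inj_on_eq_iff)

lemmas closed = zero_closed add_closed scale_closed mult_closed star_closed

lemma transport_cstar_algebra: "cstar_algebra B"
proof -
  note ts = transport_simps(3-) transport_simps(2) transport_cdiff transport_eq_iff closed
  have complete_B: "\<exists>x\<in>carrier B. (\<lambda>n. cnorm B (cdiff B (s n) x)) \<longlonglongrightarrow> 0"
    if s: "\<And>n. s n \<in> carrier B"
      and Cauchy: "\<And>r. r > 0 \<Longrightarrow> \<exists>N. \<forall>m\<ge>N. \<forall>n\<ge>N. cnorm B (cdiff B (s m) (s n)) < r"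
    for s :: "nat \<Rightarrow> 'b"
  proof -
    have "\<forall>n. \<exists>t. t \<in> carrier A \<and> s n = f t" using s by (auto simp: transport_simps(1))
    then obtain t where t: "\<And>n. t n \<in> carrier A" "\<And>n. s n = f (t n)" by metis
    have norms: "cnorm B (cdiff B (s m) (f y)) = cnorm A (cdiff A (t m) y)" if "y \<in> carrier A" for m y
      using that t by (simp add: ts diff_closed)
    obtain x where "x \<in> carrier A" "(\<lambda>n. cnorm A (cdiff A (t n) x)) \<longlonglongrightarrow> 0"
      using complete[of t] t(1) Cauchy norms[OF t(1)] unfolding t(2) by metis
    then show ?thesis by (intro bexI[of _ "f x"]) (simp_all add: norms transport_simps(1))
  qed
  show ?thesis
  proof (unfold_locales, goal_cases)
    case 29 then show ?case by (rule complete_B)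
  qed (auto simp: transport_simps(1) ts add_assoc add_zero diff_self scale_add_right scale_add_left
      scale_scale scale_one mult_assoc mult_add_left mult_add_right mult_scale_left mult_scale_right
      star_star star_add star_scale star_mult norm_nonneg norm_zero_iff norm_triangle norm_scale
      norm_mult norm_star_mult_self intro: add_commute)
qed

lemma transport_separable:
  assumes "cstar_separable A"
  shows "cstar_separable B"
proof -
  obtain D where D: "countable D" "D \<subseteq> carrier A"
    "\<And>x r. x \<in> carrier A \<Longrightarrow> r > 0 \<Longrightarrow> \<exists>d\<in>D. cnorm A (cdiff A x d) < r"
    using assms unfolding cstar_separable_def by blast
  have "\<exists>d\<in>f ` D. cnorm B (cdiff B (f x) d) < r" if x: "x \<in> carrier A" and "r > 0" for x r
  proof -
    obtain d where d: "d \<in> D" "cnorm A (cdiff A x d) < r" using D(3) x \<open>r > 0\<close> by blast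
    with x D(2) have "cnorm B (cdiff B (f x) (f d)) < r"
      by (simp add: transport_cdiff transport_simps diff_closed subset_iff)
    with d(1) show ?thesis by blast
  qed
  with D(1,2) show ?thesis
    unfolding cstar_separable_def transport_simps(1)
    by (intro exI[of _ "f ` D"]) auto
qed

text \<open>
  The representative has to be cut off outside the new carrier to be extensional.
\<close>

lemma transport_state:
  assumes \<phi>: "\<phi> \<in> state_space A"
  defines "\<psi> \<equiv> restrict (\<phi> \<circ> inv_into (carrier A) f) (carrier B)"
  shows "\<psi> \<in> state_space B" "x \<in> carrier A \<Longrightarrow> \<psi> (f x) = \<phi> x"
proof -
  have \<psi>: "\<psi> (f x) = \<phi> x" if "x \<in> carrier A" for x
    using that by (simp add: \<psi>_def transport_simps(1) inj)
  then show "x \<in> carrier A \<Longrightarrow> \<psi> (f x) = \<phi> x" .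
  obtain M where M: "\<And>x. x \<in> carrier A \<Longrightarrow> cmod (\<phi> x) \<le> M * cnorm A x"
    using \<phi> unfolding state_space_def bounded_functional_def by blast
  have "bounded_functional B \<psi>"
    unfolding bounded_functional_def transport_simps(1)
  proof (intro conjI exI[of _ M])
    show "\<forall>x\<in>f ` carrier A. cmod (\<psi> x) \<le> M * cnorm B x"
      using M by (simp add: transport_simps \<psi>)
  qed (simp_all add: transport_simps \<psi> closed state_add[OF \<phi>] state_scale[OF \<phi>])
  moreover have "unit_ball B = f ` unit_ball A"
    by (auto simp: unit_ball_def transport_simps)
  then have "functional_norm B \<psi> = functional_norm A \<phi>"
    unfolding functional_norm_def
    by (simp add: image_image) (intro SUP_cong, simp_all add: \<psi> unit_ball_def)
  then have "functional_norm B \<psi> = 1" using \<phi> by (simp add: state_space_def)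
  moreover have "\<forall>x\<in>carrier B. \<psi> (cmult B (cstar B x) x) \<in> \<real>\<^sub>\<ge>\<^sub>0"
    using state_nonneg[OF \<phi>] by (simp add: transport_simps \<psi> closed)
  ultimately show "\<psi> \<in> state_space B" by (simp add: state_space_def \<psi>_def)
qed

lemma transport_matrix_units:
  assumes "cstar_matrix_units A e \<omega>"
  shows "\<exists>\<psi>. cstar_matrix_units B (\<lambda>i j. f (e i j)) \<psi>"
proof -
  interpret M: cstar_matrix_units A e \<omega> by (fact assms)
  have sum: "unit_sum B (\<lambda>i j. f (e i j)) n = f (unit_sum A e n)" for n
    by (induction n) (simp_all add: transport_simps M.p_closed M.unit_closed)
  note \<psi> = transport_state[OF M.state]
  have "cstar_matrix_units B (\<lambda>i j. f (e i j)) (restrict (\<omega> \<circ> inv_into (carrier A) f) (carrier B))"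
  proof (intro cstar_matrix_units.intro transport_cstar_algebra cstar_matrix_units_axioms.intro \<psi>(1))
    show "restrict (\<omega> \<circ> inv_into (carrier A) f) (carrier B) (f (e 0 0)) = 1"
      using \<psi>(2)[OF M.unit_closed] M.state_unit by simp
    show "(\<lambda>n. cnorm B (cdiff B (cmult B (unit_sum B (\<lambda>i j. f (e i j)) n) x) x)) \<longlonglongrightarrow> 0"
      if x: "x \<in> carrier B" for x
    proof -
      obtain y where y: "y \<in> carrier A" "x = f y" using x by (auto simp: transport_simps(1))
      then show ?thesis
        using M.approximate_unit[OF y(1)]
        by (simp add: sum transport_simps transport_cdiff M.p_closed closed diff_closed)
    qed
  qed (simp_all add: transport_simps M.unit_closed M.unit_mult M.unit_star)
  then show ?thesis by blast
qed

end

section \<open>The sequence space of square-summable sequences\<close>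

lemma square_summable_add:
  fixes x y :: "nat \<Rightarrow> complex"
  assumes "summable (\<lambda>i. (cmod (x i))\<^sup>2)" "summable (\<lambda>i. (cmod (y i))\<^sup>2)"
  shows "summable (\<lambda>i. (cmod (x i + y i))\<^sup>2)"
proof (rule summable_comparison_test')
  show "summable (\<lambda>i. 2 * (cmod (x i))\<^sup>2 + 2 * (cmod (y i))\<^sup>2)"
    by (intro summable_add summable_mult assms)
  show "norm ((cmod (x i + y i))\<^sup>2) \<le> 2 * (cmod (x i))\<^sup>2 + 2 * (cmod (y i))\<^sup>2" for i
  proof -
    have "(cmod (x i + y i))\<^sup>2 \<le> (cmod (x i) + cmod (y i))\<^sup>2"
      by (intro power_mono norm_triangle_ineq) simp
    also have "\<dots> \<le> 2 * (cmod (x i))\<^sup>2 + 2 * (cmod (y i))\<^sup>2"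
      using zero_le_power2[of "cmod (x i) - cmod (y i)"] by (simp add: power2_eq_square algebra_simps)
    finally show ?thesis by simp
  qed
qed

lemma square_summable_mult:
  fixes x :: "nat \<Rightarrow> complex"
  assumes "summable (\<lambda>i. (cmod (x i))\<^sup>2)"
  shows "summable (\<lambda>i. (cmod (c * x i))\<^sup>2)"
  using summable_mult[OF assms, of "(cmod c)\<^sup>2"] by (simp add: norm_mult power_mult_distrib)

text \<open>
  The standard separable infinite-dimensional Hilbert space, which provides a concrete algebra of compact
  operators.
\<close>

typedef ell2 = "{x :: nat \<Rightarrow> complex. summable (\<lambda>i. (cmod (x i))\<^sup>2)}"
  morphisms coord Abs_ell2
  by (rule exI[of _ "\<lambda>_. 0"]) simp

setup_lifting type_definition_ell2

lemma coord_summable: "summable (\<lambda>i. (cmod (coord x i))\<^sup>2)"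
  using coord[of x] by simp

lemma ell2_eqI: "(\<And>i. coord x i = coord y i) \<Longrightarrow> x = y"
  by (simp add: coord_inject[symmetric] fun_eq_iff)

instantiation ell2 :: real_vector
begin

lift_definition zero_ell2 :: ell2 is "\<lambda>_. 0" by simp

lift_definition plus_ell2 :: "ell2 \<Rightarrow> ell2 \<Rightarrow> ell2" is "\<lambda>x y i. x i + y i"
  by (rule square_summable_add)

lift_definition uminus_ell2 :: "ell2 \<Rightarrow> ell2" is "\<lambda>x i. - x i" by simp

lift_definition minus_ell2 :: "ell2 \<Rightarrow> ell2 \<Rightarrow> ell2" is "\<lambda>x y i. x i - y i"
  using square_summable_add[of _ "\<lambda>i. - y i" for y] by fastforce

lift_definition scaleR_ell2 :: "real \<Rightarrow> ell2 \<Rightarrow> ell2" is "\<lambda>r x i. of_real r * x i"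
  by (rule square_summable_mult)

instance
  by standard (rule ell2_eqI,
    simp add: zero_ell2.rep_eq plus_ell2.rep_eq uminus_ell2.rep_eq minus_ell2.rep_eq
      scaleR_ell2.rep_eq algebra_simps)+

end

lemmas coord_simps = zero_ell2.rep_eq plus_ell2.rep_eq uminus_ell2.rep_eq minus_ell2.rep_eq scaleR_ell2.rep_eq

instantiation ell2 :: real_normed_vector
begin

definition norm_ell2 :: "ell2 \<Rightarrow> real" where "norm_ell2 x = sqrt (\<Sum>i. (cmod (coord x i))\<^sup>2)"
definition dist_ell2 :: "ell2 \<Rightarrow> ell2 \<Rightarrow> real" where "dist_ell2 x y = norm (x - y)"
definition sgn_ell2 :: "ell2 \<Rightarrow> ell2" where "sgn_ell2 x = x /\<^sub>R norm x"
definition uniformity_ell2 :: "(ell2 \<times> ell2) filter"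
  where "uniformity_ell2 = (INF e\<in>{0 <..}. principal {(x, y). dist x y < e})"
definition open_ell2 :: "ell2 set \<Rightarrow> bool"
  where "open_ell2 U = (\<forall>x\<in>U. eventually (\<lambda>(x', y). x' = x \<longrightarrow> y \<in> U) uniformity)"

lemma L2_set_coord_le: "L2_set (\<lambda>i. cmod (coord x i)) {..<n} \<le> norm x"
  unfolding L2_set_def norm_ell2_def
  by (intro real_sqrt_le_mono sum_le_suminf coord_summable) auto

text \<open>
  Reduces norm inequalities, in particular the triangle inequality, to finite sections.
\<close>

lemma norm_ell2_le_iff: "r \<ge> 0 \<Longrightarrow> norm x \<le> r \<longleftrightarrow> (\<forall>n. L2_set (\<lambda>i. cmod (coord x i)) {..<n} \<le> r)"
proof
  assume r: "r \<ge> 0" and *: "\<forall>n. L2_set (\<lambda>i. cmod (coord x i)) {..<n} \<le> r"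
  have "(\<Sum>i<n. (cmod (coord x i))\<^sup>2) \<le> r\<^sup>2" for n
    using * r unfolding L2_set_def by (metis real_sqrt_le_iff real_sqrt_unique)
  then have "(\<Sum>i. (cmod (coord x i))\<^sup>2) \<le> r\<^sup>2"
    by (intro suminf_le_const coord_summable)
  then show "norm x \<le> r" unfolding norm_ell2_def using r by (simp add: real_le_lsqrt)
qed (use L2_set_coord_le order_trans in blast)

instance
proof
  fix x y :: ell2 and r :: real
  show "norm x = 0 \<longleftrightarrow> x = 0"
  proof
    assume "norm x = 0"
    then have "(\<Sum>i. (cmod (coord x i))\<^sup>2) = 0" by (simp add: norm_ell2_def)
    then have "coord x i = 0" for i
      using suminf_eq_zero_iff[OF coord_summable[of x]] by simp
    then show "x = 0" by (intro ell2_eqI) (simp add: coord_simps)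
  qed (simp add: norm_ell2_def coord_simps)
  show "norm (r *\<^sub>R x) = \<bar>r\<bar> * norm x"
    by (simp add: norm_ell2_def coord_simps norm_mult power_mult_distrib suminf_mult coord_summable
        real_sqrt_mult)
  have "norm x \<ge> 0" "norm y \<ge> 0"
    using L2_set_coord_le[of x 0] L2_set_coord_le[of y 0] by simp_all
  moreover have "L2_set (\<lambda>i. cmod (coord (x + y) i)) {..<n} \<le> norm x + norm y" for n
  proof -
    have "L2_set (\<lambda>i. cmod (coord (x + y) i)) {..<n}
        \<le> L2_set (\<lambda>i. cmod (coord x i) + cmod (coord y i)) {..<n}"
      by (intro L2_set_mono) (simp_all add: coord_simps norm_triangle_ineq)
    also have "\<dots> \<le> L2_set (\<lambda>i. cmod (coord x i)) {..<n} + L2_set (\<lambda>i. cmod (coord y i)) {..<n}"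
      by (rule L2_set_triangle_ineq)
    finally show ?thesis using L2_set_coord_le[of x n] L2_set_coord_le[of y n] by linarith
  qed
  ultimately show "norm (x + y) \<le> norm x + norm y" by (simp add: norm_ell2_le_iff)
qed (simp_all add: dist_ell2_def sgn_ell2_def uniformity_ell2_def open_ell2_def)

end

lemma norm_ell2_square: "(norm x)\<^sup>2 = (\<Sum>i. (cmod (coord x i))\<^sup>2)" for x :: ell2
  unfolding norm_ell2_def by (intro real_sqrt_pow2 suminf_nonneg coord_summable) simp

lemma summable_coord_product: "summable (\<lambda>i. coord x i * cnj (coord y i))"
proof (rule summable_comparison_test')
  show "summable (\<lambda>i. (cmod (coord x i))\<^sup>2 + (cmod (coord y i))\<^sup>2)"
    by (intro summable_add coord_summable)
  show "norm (coord x i * cnj (coord y i)) \<le> (cmod (coord x i))\<^sup>2 + (cmod (coord y i))\<^sup>2" for i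
    using sum_squares_bound[of "cmod (coord x i)" "cmod (coord y i)"]
      mult_nonneg_nonneg[OF norm_ge_zero norm_ge_zero, of "coord x i" "coord y i"]
    unfolding norm_mult complex_mod_cnj by linarith
qed

instantiation ell2 :: complex_inner
begin

lift_definition scaleC_ell2 :: "complex \<Rightarrow> ell2 \<Rightarrow> ell2" is "\<lambda>c x i. c * x i"
  by (rule square_summable_mult)

definition cinner_ell2 :: "ell2 \<Rightarrow> ell2 \<Rightarrow> complex" where
  "cinner_ell2 x y = (\<Sum>i. coord x i * cnj (coord y i))"

instance
proof
  fix c d :: complex and r :: real and x y z :: ell2
  show "scaleC c (x + y) = scaleC c x + scaleC c y" "scaleC (c + d) x = scaleC c x + scaleC d x"
    "scaleC c (scaleC d x) = scaleC (c * d) x" "scaleC (complex_of_real r) x = r *\<^sub>R x"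
    by (rule ell2_eqI, simp add: coord_simps scaleC_ell2.rep_eq algebra_simps)+
  show "cinner x y = cnj (cinner y x)"
  proof -
    have "(\<lambda>i. cnj (coord y i * cnj (coord x i))) sums cnj (cinner y x)"
      unfolding cinner_ell2_def by (subst sums_cnj) (rule summable_sums[OF summable_coord_product])
    then show ?thesis by (simp add: cinner_ell2_def sums_iff mult.commute)
  qed
  show "cinner (x + y) z = cinner x z + cinner y z"
    by (simp add: cinner_ell2_def coord_simps distrib_right suminf_add summable_coord_product)
  show "cinner (scaleC c x) y = c * cinner x y"
    by (simp add: cinner_ell2_def scaleC_ell2.rep_eq mult.assoc suminf_mult summable_coord_product)
  have self: "cinner x x = of_real ((norm x)\<^sup>2)"
    using suminf_of_real[OF coord_summable[of x], where 'a = complex]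
    unfolding cinner_ell2_def norm_ell2_square by (simp only: complex_norm_square)
  show "cinner x x \<in> \<real>\<^sub>\<ge>\<^sub>0" unfolding self by simp
  show "norm x = sqrt (Re (cinner x x))" unfolding self by simp
qed

end

lemma coord_le_norm: "cmod (coord x i) \<le> norm x" for x :: ell2
proof -
  have "cmod (coord x i) \<le> L2_set (\<lambda>i. cmod (coord x i)) {..<Suc i}"
    by (rule member_le_L2_set) simp_all
  with L2_set_coord_le[of x "Suc i"] show ?thesis by linarith
qed

text \<open>
  A Cauchy sequence converges in each coordinate. The Cauchy condition bounds the finite sections of
  \<open>X m - X n\<close>; letting \<open>n\<close> tend to infinity bounds those of the difference between \<open>X m\<close> and the coordinatewise
  limit, so that the latter is square-summable and is the limit in norm.
\<close>

instance ell2 :: chilbert_space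
proof
  fix X :: "nat \<Rightarrow> ell2" assume X: "Cauchy X"
  have "Cauchy (\<lambda>n. coord (X n) i)" for i
  proof (rule metric_CauchyI)
    fix r :: real assume "r > 0"
    then obtain N where "\<And>m n. m \<ge> N \<Longrightarrow> n \<ge> N \<Longrightarrow> dist (X m) (X n) < r"
      using metric_CauchyD[OF X] by blast
    moreover have "dist (coord (X m) i) (coord (X n) i) \<le> dist (X m) (X n)" for m n
      using coord_le_norm[of "X m - X n" i] by (simp add: dist_norm coord_simps)
    ultimately show "\<exists>M. \<forall>m\<ge>M. \<forall>n\<ge>M. dist (coord (X m) i) (coord (X n) i) < r"
      by (meson order_le_less_trans)
  qed
  then have "\<forall>i. \<exists>l. (\<lambda>n. coord (X n) i) \<longlonglongrightarrow> l"
    using Cauchy_convergent convergent_def by blast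
  then obtain y where y: "\<And>i. (\<lambda>n. coord (X n) i) \<longlonglongrightarrow> y i" by metis
  have close: "\<exists>N. \<forall>m\<ge>N. \<forall>k. (\<Sum>i<k. (cmod (coord (X m) i - y i))\<^sup>2) \<le> r\<^sup>2" if r: "r > 0" for r
  proof -
    obtain N where N: "\<And>m n. m \<ge> N \<Longrightarrow> n \<ge> N \<Longrightarrow> dist (X m) (X n) < r"
      using metric_CauchyD[OF X r] by blast
    have "(\<Sum>i<k. (cmod (coord (X m) i - y i))\<^sup>2) \<le> r\<^sup>2" if m: "m \<ge> N" for m k
    proof (rule LIMSEQ_le_const2)
      show "(\<lambda>n. \<Sum>i<k. (cmod (coord (X m) i - coord (X n) i))\<^sup>2) \<longlonglongrightarrow> (\<Sum>i<k. (cmod (coord (X m) i - y i))\<^sup>2)"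
        by (intro tendsto_intros y)
      have "(\<Sum>i<k. (cmod (coord (X m) i - coord (X n) i))\<^sup>2) \<le> r\<^sup>2" if "n \<ge> N" for n
      proof -
        have "(\<Sum>i<k. (cmod (coord (X m - X n) i))\<^sup>2) \<le> (norm (X m - X n))\<^sup>2"
          unfolding norm_ell2_square by (intro sum_le_suminf coord_summable) auto
        also have "\<dots> \<le> r\<^sup>2"
          using N[OF m that] by (intro power_mono) (auto simp: dist_norm)
        finally show ?thesis by (simp add: coord_simps)
      qed
      then show "\<exists>N. \<forall>n\<ge>N. (\<Sum>i<k. (cmod (coord (X m) i - coord (X n) i))\<^sup>2) \<le> r\<^sup>2" by blast
    qed
    then show ?thesis by blast
  qed
  obtain m where m: "\<And>k. (\<Sum>i<k. (cmod (coord (X m) i - y i))\<^sup>2) \<le> 1\<^sup>2"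
    using close[OF zero_less_one] by blast
  have "summable (\<lambda>i. (cmod (coord (X m) i - y i))\<^sup>2)"
    by (rule summableI_nonneg_bounded[OF _ m]) simp
  \<comment> \<open>The limit is \<open>X m + (- 1) * (X m - y)\<close>.\<close>
  then have "summable (\<lambda>i. (cmod (- 1 * (coord (X m) i - y i)))\<^sup>2)"
    by (rule square_summable_mult)
  from square_summable_add[OF coord_summable this, of "X m"]
  have "summable (\<lambda>i. (cmod (y i))\<^sup>2)" by simp
  then have cy: "coord (Abs_ell2 y) = y" by (simp add: Abs_ell2_inverse)
  have "X \<longlonglongrightarrow> Abs_ell2 y"
  proof (rule metric_LIMSEQ_I)
    fix r :: real assume "r > 0"
    then have "r / 2 > 0" by simp
    then obtain N where N: "\<And>m k. m \<ge> N \<Longrightarrow> (\<Sum>i<k. (cmod (coord (X m) i - y i))\<^sup>2) \<le> (r / 2)\<^sup>2"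
      using close by blast
    have "dist (X m) (Abs_ell2 y) < r" if "m \<ge> N" for m
    proof -
      have "(norm (X m - Abs_ell2 y))\<^sup>2 \<le> (r / 2)\<^sup>2"
        unfolding norm_ell2_square using N[OF that]
        by (intro suminf_le_const coord_summable) (simp add: coord_simps cy)
      then have "norm (X m - Abs_ell2 y) \<le> r / 2"
        by (rule power2_le_imp_le) (use \<open>r > 0\<close> in simp)
      with \<open>r > 0\<close> show ?thesis by (simp add: dist_norm)
    qed
    then show "\<exists>N. \<forall>n\<ge>N. dist (X n) (Abs_ell2 y) < r" by blast
  qed
  then show "convergent X" by (auto simp: convergent_def)
qed

lift_definition std_basis :: "nat \<Rightarrow> ell2" is "\<lambda>i j. if j = i then 1 else 0"
  by (rule summable_finite[of "{i}" for i]) auto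

lemma cinner_std_basis: "cinner x (std_basis i) = coord x i"
proof -
  have "(\<lambda>j. coord x j * cnj (coord (std_basis i) j)) sums (\<Sum>j\<in>{i}. coord x j * cnj (coord (std_basis i) j))"
    by (rule sums_finite) (simp_all add: std_basis.rep_eq)
  then show ?thesis by (simp add: cinner_ell2_def sums_iff std_basis.rep_eq)
qed

lemma orthonormal_basis_std_basis: "orthonormal_basis std_basis"
proof -
  interpret orthonormal_sequence std_basis
    by unfold_locales (simp add: cinner_std_basis std_basis.rep_eq)
  show ?thesis
  proof (unfold_locales, rule proj_tendstoI)
    fix z assume "\<And>i. cinner z (std_basis i) = 0"
    then show "z = 0" by (intro ell2_eqI) (simp add: cinner_std_basis coord_simps)
  qed
qed

section \<open>Failure of joint continuity\<close>

text \<open>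
  The algebra of matrices of compact operators on \<open>ell2\<close>: an operator corresponds to the matrix with
  entries \<open>\<langle>T e\<^sub>j, e\<^sub>i\<rangle>\<close>.
\<close>

theorem separable_cstar_algebra_mult_discontinuous:
  "\<exists>A :: (nat \<Rightarrow> nat \<Rightarrow> complex) cstar_record. cstar_algebra A \<and> cstar_separable A \<and>
     \<not> mult_jointly_continuous_on A (unit_ball A)"
proof -
  let ?K = "compact_operators :: (ell2 \<Rightarrow> ell2) cstar_record"
  interpret ob: orthonormal_basis std_basis by (rule orthonormal_basis_std_basis)
  interpret cstar_transport ?K "\<lambda>T i j. cinner (T (std_basis j)) (std_basis i)"
    by (intro cstar_transport.intro cstar_algebra_compact_operators cstar_transport_axioms.intro
        ob.matrix_entries_inj)
  obtain \<psi> where "cstar_matrix_units B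
      (\<lambda>k l i j. cinner (ob.unit k l (std_basis j)) (std_basis i)) \<psi>"
    using transport_matrix_units[OF ob.compact_operators_matrix_units] by blast
  then have "\<not> mult_jointly_continuous_on B (unit_ball B)"
    by (rule cstar_matrix_units.mult_not_jointly_continuous)
  with transport_cstar_algebra transport_separable[OF ob.compact_operators_separable]
  show ?thesis by blast
qed

theorem proposition3p11:
  shows "(separable_space (euclidean :: 'h::chilbert_space topology) \<and>
            infinite_dimensional TYPE('h) \<longrightarrow>
            \<not> mult_jointly_continuous_on (compact_operators :: ('h \<Rightarrow> 'h) cstar_record)
                (unit_ball compact_operators)) \<and>
         (\<exists>A :: (nat \<Rightarrow> nat \<Rightarrow> complex) cstar_record.
            cstar_algebra A \<and> cstar_separable A \<and>
            (\<exists>S. cstar_bounded A S \<and> \<not> mult_jointly_continuous_on A S))"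
proof (intro conjI impI)
  assume "separable_space (euclidean :: 'h topology) \<and> infinite_dimensional TYPE('h)"
  then obtain e :: "nat \<Rightarrow> 'h" where "orthonormal_basis e"
    using orthonormal_basis_exists by blast
  then interpret orthonormal_basis e .
  show "\<not> mult_jointly_continuous_on (compact_operators :: ('h \<Rightarrow> 'h) cstar_record)
      (unit_ball compact_operators)"
    by (rule cstar_matrix_units.mult_not_jointly_continuous[OF compact_operators_matrix_units])
next
  have "cstar_bounded A (unit_ball A)" for A :: "(nat \<Rightarrow> nat \<Rightarrow> complex) cstar_record"
    by (auto simp: cstar_bounded_def unit_ball_def)
  with separable_cstar_algebra_mult_discontinuous
  show "\<exists>A :: (nat \<Rightarrow> nat \<Rightarrow> complex) cstar_record. cstar_algebra A \<and> cstar_separable A \<and>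
      (\<exists>S. cstar_bounded A S \<and> \<not> mult_jointly_continuous_on A S)"
    by blast
qed

end
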